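(* Let $Z$ be an autonomous piecewise smooth vector field on $\mathbb{R}^n$ with switching set $\Sigma$ and solution $\varphi$, and let $x\in\mathbb{R}^n$. Let $T>0$ be such that $\{\varphi(t;x)\colon t\in[0,T]\}$ is well defined and intersects $\Sigma$ only in crossing points. Then the time-$T$-map $\Phi^T$ is a homeomorphism in a neighborhood of $x$ (that is, from some neighborhood of $x$ onto its image, a neighborhood of $\Phi^T(x)$).
   Context: Smooth means $\mathcal{C}^\infty$. Let $n\geq 2$, $h_1,\dots,h_N\colon\mathbb{R}^n\to\mathbb{R}$ smooth functions ($0$ need not be a regular value), $\Sigma_i=h_i^{-1}(\{0\})$, $\Sigma=\bigcup_{i=1}^N\Sigma_i$ (the switching set), and let $A_1,\dots,A_k$ ($k\geq2$) be the connected components of $\mathbb{R}^n\setminus\Sigma$. An autonomous piecewise smooth vector field $Z=(X_1,\dots,X_k)$ consists of smooth vector fields $X_j$ (its components), each defined in a neighborhood of $\overline{A_j}$. A point $x_0\in\Sigma$ is a crossing point if: (i) there is a unique $i$ with $x_0\in\Sigma_i$; (ii) $\nabla h_i(x_0)\ne0$; (iii) $\langle X_a(x_0),\nabla h_i(x_0)\rangle\,\langle X_b(x_0),\nabla h_i(x_0)\rangle>0$, where $X_a,X_b$ are the only two components with $x_0\in\overline{A_a}\cap\overline{A_b}$. The solution $\varphi(t;x)$ of $Z$ with $\varphi(0;x)=x$ follows $X_j$ while in $A_j$ and, at crossing points (including possibly the initial point), is the concatenation of the trajectories of the two components there (consistent with their common crossing direction); it is considered on time intervals on which it meets $\Sigma$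 only at crossing points. The time-$T$-map is $\Phi^T(r)=\varphi(T;r)$, defined at points $r$ for which the arc of orbit from time $0$ to time $T$ is well defined in this sense. *)

theory Defs
  imports "HOL-Analysis.Analysis"
begin

(* The set S is meant to be open: derivatives are taken in the full space. *)
primrec Ck_on :: "nat \<Rightarrow> 'a::real_normed_vector set \<Rightarrow> ('a \<Rightarrow> 'b::real_normed_vector) \<Rightarrow> bool" where
  "Ck_on 0 S f \<longleftrightarrow> continuous_on S f"
| "Ck_on (Suc m) S f \<longleftrightarrow>
     (\<forall>x\<in>S. f differentiable (at x)) \<and>
     (\<forall>v. Ck_on m S (\<lambda>x. frechet_derivative f (at x) v))"

definition smooth_on :: "'a::real_normed_vector set \<Rightarrow> ('a \<Rightarrow> 'b::real_normed_vector) \<Rightarrow> bool" where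
  "smooth_on S f \<longleftrightarrow> (\<forall>m. Ck_on m S f)"

definition gradient :: "('a::real_inner \<Rightarrow> real) \<Rightarrow> 'a \<Rightarrow> 'a" where
  "gradient f x = (THE D. GDERIV f x :> D)"

definition switching_set :: "nat \<Rightarrow> (nat \<Rightarrow> 'a \<Rightarrow> real) \<Rightarrow> 'a set" where
  "switching_set N h = (\<Union>i\<in>{1..N}. h i -` {0})"

(* A 1, ..., A k enumerate, without repetition, the connected components of the complement
   of the switching set.  Each X j is a total function, but nothing is required of it away from
   a neighbourhood of closure (A j). *)
definition piecewise_smooth_field ::
  "nat \<Rightarrow> (nat \<Rightarrow> real ^ 'n \<Rightarrow> real) \<Rightarrow> nat \<Rightarrow> (nat \<Rightarrow> (real ^ 'n) set) \<Rightarrow>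
   (nat \<Rightarrow> real ^ 'n \<Rightarrow> real ^ 'n) \<Rightarrow> bool" where
  "piecewise_smooth_field N h k A X \<longleftrightarrow>
     (\<forall>i\<in>{1..N}. smooth_on UNIV (h i)) \<and>
     k \<ge> 2 \<and>
     bij_betw A {1..k} (components (- switching_set N h)) \<and>
     (\<forall>j\<in>{1..k}. \<exists>U. open U \<and> closure (A j) \<subseteq> U \<and> smooth_on U (X j))"

definition crossing_point ::
  "nat \<Rightarrow> (nat \<Rightarrow> real ^ 'n \<Rightarrow> real) \<Rightarrow> nat \<Rightarrow> (nat \<Rightarrow> (real ^ 'n) set) \<Rightarrow>
   (nat \<Rightarrow> real ^ 'n \<Rightarrow> real ^ 'n) \<Rightarrow> real ^ 'n \<Rightarrow> bool" where
  "crossing_point N h k A X p \<longleftrightarrow>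
     (\<exists>i\<in>{1..N}.
        h i p = 0 \<and> (\<forall>i'\<in>{1..N}. h i' p = 0 \<longrightarrow> i' = i) \<and>
        gradient (h i) p \<noteq> 0 \<and>
        (\<exists>a b. a \<noteq> b \<and> {j\<in>{1..k}. p \<in> closure (A j)} = {a, b} \<and>
           (X a p \<bullet> gradient (h i) p) * (X b p \<bullet> gradient (h i) p) > 0))"

definition trajectory_on ::
  "('a::real_normed_vector \<Rightarrow> 'a) \<Rightarrow> real set \<Rightarrow> (real \<Rightarrow> 'a) \<Rightarrow> bool" where
  "trajectory_on F I \<gamma> \<longleftrightarrow> (\<forall>s\<in>I. (\<gamma> has_vector_derivative F (\<gamma> s)) (at s within I))"

(* gamma is a solution on the time interval [0,T] starting at x.  At a time t at which gamma is on
   the switching set, gamma is locally the concatenation of a trajectory of X a (up to time t) and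
   a trajectory of X b (from time t on).  Consistency with the crossing direction is expressed by
   gamma lying in A a just before and in A b just after time t.  For t = 0 (t = T) the
   incoming (outgoing) part is void. *)
definition solution_on ::
  "nat \<Rightarrow> (nat \<Rightarrow> real ^ 'n \<Rightarrow> real) \<Rightarrow> nat \<Rightarrow> (nat \<Rightarrow> (real ^ 'n) set) \<Rightarrow>
   (nat \<Rightarrow> real ^ 'n \<Rightarrow> real ^ 'n) \<Rightarrow> real \<Rightarrow> real ^ 'n \<Rightarrow> (real \<Rightarrow> real ^ 'n) \<Rightarrow> bool" where
  "solution_on N h k A X T x \<gamma> \<longleftrightarrow>
     \<gamma> 0 = x \<and>
     (\<forall>t\<in>{0..T}.
        (\<forall>j\<in>{1..k}. \<gamma> t \<in> A j \<longrightarrow>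
           (\<gamma> has_vector_derivative X j (\<gamma> t)) (at t within {0..T})) \<and>
        (\<gamma> t \<in> switching_set N h \<longrightarrow>
           crossing_point N h k A X (\<gamma> t) \<and>
           (\<exists>a\<in>{1..k}. \<exists>b\<in>{1..k}. \<exists>\<epsilon>>0.
              a \<noteq> b \<and> \<gamma> t \<in> closure (A a) \<inter> closure (A b) \<and>
              trajectory_on (X a) ({0..T} \<inter> {t - \<epsilon>..t}) \<gamma> \<and>
              \<gamma> ` ({0..T} \<inter> {t - \<epsilon><..<t}) \<subseteq> A a \<and>
              trajectory_on (X b) ({0..T} \<inter> {t..t + \<epsilon>}) \<gamma> \<and>
              \<gamma> ` ({0..T} \<inter> {t<..<t + \<epsilon>}) \<subseteq> A b)))"

definition arc_well_defined ::
  "nat \<Rightarrow> (nat \<Rightarrow> real ^ 'n \<Rightarrow> real) \<Rightarrow> nat \<Rightarrow> (nat \<Rightarrow> (real ^ 'n) set) \<Rightarrow>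
   (nat \<Rightarrow> real ^ 'n \<Rightarrow> real ^ 'n) \<Rightarrow> real \<Rightarrow> real ^ 'n \<Rightarrow> bool" where
  "arc_well_defined N h k A X T x \<longleftrightarrow> (\<exists>\<gamma>. solution_on N h k A X T x \<gamma>)"

(* Meaningful for t \<ge> 0 with arc_well_defined N h k A X t x. *)
definition flow ::
  "nat \<Rightarrow> (nat \<Rightarrow> real ^ 'n \<Rightarrow> real) \<Rightarrow> nat \<Rightarrow> (nat \<Rightarrow> (real ^ 'n) set) \<Rightarrow>
   (nat \<Rightarrow> real ^ 'n \<Rightarrow> real ^ 'n) \<Rightarrow> real \<Rightarrow> real ^ 'n \<Rightarrow> real ^ 'n" where
  "flow N h k A X t x = (THE y. \<exists>\<gamma>. solution_on N h k A X t x \<gamma> \<and> \<gamma> t = y)"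

definition time_map ::
  "nat \<Rightarrow> (nat \<Rightarrow> real ^ 'n \<Rightarrow> real) \<Rightarrow> nat \<Rightarrow> (nat \<Rightarrow> (real ^ 'n) set) \<Rightarrow>
   (nat \<Rightarrow> real ^ 'n \<Rightarrow> real ^ 'n) \<Rightarrow> real \<Rightarrow> real ^ 'n \<Rightarrow> real ^ 'n" where
  "time_map N h k A X T r = flow N h k A X T r"

end

theory Submission
  imports Defs
begin

text \<open>Near every point of the orbit the flow for a short time is continuous in the starting point:
  away from \<open>\<Sigma>\<close> this is the flow of a single smooth field, and at a crossing point one follows the
  incoming field up to the hitting time of \<open>\<Sigma>\<close>, which is continuous by transversality, and the
  outgoing field afterwards.  Compactness of the time interval then gives a continuous time-\<open>T\<close>-map
  near \<open>x\<close>.  Reversing time turns \<open>Z\<close> into the piecewise smooth field \<open>-Z\<close> with the same crossing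
  points, so the same argument at \<open>\<Phi>\<^sup>T(x)\<close> yields a continuous map, which is the inverse by
  uniqueness of solutions.\<close>

section \<open>Trajectories of a single vector field\<close>

text \<open>At a time on the switching set, \<open>solution_on\<close> prescribes both sides at once
  and relative to \<open>{0..T}\<close>, a form that resists cutting and gluing. It is traded for
  two independent conditions: some field to depart with at each time before \<open>T\<close>, some
  field to arrive with at each time after 0. That the right component is used at a crossing point
  need not be demanded: a signed switching function \<open>H\<close> grows at positive speed along
  both adjacent fields, so its sign just before and just after the crossing is forced. The same fact
  makes solutions unique although the field jumps. Strict growth of \<open>H\<close> along lines and
  along trajectories also replaces the implicit function theorem. The hitting time is the place
  where \<open>H\<close> changes sign along an incoming trajectory, which can be prolonged past the
  surface because each field is smooth in a neighbourhood of the closure of its component; its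
  continuity is the openness of the sign conditions. Openness of the image is not a consequence of
  invariance of domain: the image is cut out as a preimage under the backward map.\<close>

lemma trajectory_on_subset:
  "trajectory_on F I \<gamma> \<Longrightarrow> J \<subseteq> I \<Longrightarrow> trajectory_on F J \<gamma>"
  unfolding trajectory_on_def by (meson has_vector_derivative_within_subset subsetD)

lemma trajectory_on_continuous: "trajectory_on F I \<gamma> \<Longrightarrow> continuous_on I \<gamma>"
  unfolding trajectory_on_def continuous_on_eq_continuous_within
  using has_vector_derivative_continuous by blast

lemma trajectory_on_cong:
  assumes "trajectory_on F I \<gamma>" "\<And>s. s \<in> I \<Longrightarrow> \<gamma>' s = \<gamma> s" "\<And>s. s \<in> I \<Longrightarrow> G (\<gamma> s) = F (\<gamma> s)"
  shows "trajectory_on G I \<gamma>'"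
  unfolding trajectory_on_def
proof
  fix s assume s: "s \<in> I"
  then have "(\<gamma> has_vector_derivative F (\<gamma> s)) (at s within I)"
    using assms(1) by (auto simp: trajectory_on_def)
  then show "(\<gamma>' has_vector_derivative G (\<gamma>' s)) (at s within I)"
    using assms(2,3) s by (metis has_vector_derivative_transform)
qed

lemma trajectory_on_affine:
  assumes "trajectory_on F I \<gamma>" "\<And>s. s \<in> J \<Longrightarrow> c * s + d \<in> I"
  shows "trajectory_on (\<lambda>y. c *\<^sub>R F y) J (\<lambda>s. \<gamma> (c * s + d))"
  unfolding trajectory_on_def
proof
  fix s assume s: "s \<in> J"
  have 1: "((\<lambda>s. c * s + d) has_vector_derivative c) (at s within J)"
    by (auto intro!: derivative_eq_intros)
  have "(\<gamma> has_vector_derivative F (\<gamma> (c * s + d))) (at (c * s + d) within I)"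
    using assms s by (auto simp: trajectory_on_def)
  then have 2: "(\<gamma> has_vector_derivative F (\<gamma> (c * s + d))) (at (c * s + d) within (\<lambda>s. c * s + d) ` J)"
    by (rule has_vector_derivative_within_subset) (use assms(2) in auto)
  show "((\<lambda>s. \<gamma> (c * s + d)) has_vector_derivative c *\<^sub>R F (\<gamma> (c * s + d))) (at s within J)"
    using vector_diff_chain_within[OF 1 2] by (simp add: o_def)
qed

lemma trajectory_on_shift:
  assumes "trajectory_on F I \<gamma>" "\<And>s. s \<in> J \<Longrightarrow> s + d \<in> I"
  shows "trajectory_on F J (\<lambda>s. \<gamma> (s + d))"
  using trajectory_on_affine[of F I \<gamma> J 1 d] assms by simp

lemma trajectory_on_reverse:
  assumes "trajectory_on F I \<gamma>" "\<And>s. s \<in> J \<Longrightarrow> d - s \<in> I"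
  shows "trajectory_on (\<lambda>y. - F y) J (\<lambda>s. \<gamma> (d - s))"
  using trajectory_on_affine[of F I \<gamma> J "-1" d] assms by simp

text \<open>The exponentially weighted squared distance \<open>w\<close> is nonincreasing; squaring
  keeps it differentiable at times where the two curves meet. The bound serves twice: for continuous
  dependence on the starting point and for uniqueness.\<close>

lemma trajectory_gronwall:
  fixes u v :: "real \<Rightarrow> 'a::real_inner"
  assumes u: "trajectory_on F {t0..t1} u" and v: "trajectory_on F {t0..t1} v"
    and L: "L-lipschitz_on S F" and S: "u ` {t0..t1} \<subseteq> S" "v ` {t0..t1} \<subseteq> S"
    and t: "t \<in> {t0..t1}"
  shows "norm (u t - v t) \<le> exp (L * (t - t0)) * norm (u t0 - v t0)"
proof -
  define z where "z s = u s - v s" for s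
  \<comment> \<open>The factor 2 in the exponent matches the square: by Cauchy-Schwarz and the
    Lipschitz bound, the squared distance grows at relative rate at most
    \<open>2 * L\<close>.\<close>
  define w where "w s = exp (- 2 * L * (s - t0)) * (z s \<bullet> z s)" for s
  have cont: "continuous_on {t0..t1} w"
    unfolding w_def z_def
    by (intro continuous_intros trajectory_on_continuous[OF u] trajectory_on_continuous[OF v])
  have "w t \<le> w t0"
  proof (rule DERIV_nonpos_imp_decreasing_open[where f = w])
    show "t0 \<le> t" using t by simp
    show "continuous_on {t0..t} w"
      by (rule continuous_on_subset[OF cont]) (use t in auto)
    fix s assume s: "t0 < s" "s < t"
    then have at: "at s within {t0..t1} = at s"
      using t by (intro at_within_Icc_at) auto
    have "(u has_vector_derivative F (u s)) (at s within {t0..t1})"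
      "(v has_vector_derivative F (v s)) (at s within {t0..t1})"
      using u v s t by (auto simp: trajectory_on_def)
    then have "(z has_vector_derivative F (u s) - F (v s)) (at s)"
      unfolding z_def at by (rule has_vector_derivative_diff)
    then have dz: "(z has_derivative (\<lambda>h. h *\<^sub>R (F (u s) - F (v s)))) (at s)"
      by (simp add: has_vector_derivative_def)
    have dzz: "((\<lambda>s. z s \<bullet> z s) has_real_derivative 2 * (z s \<bullet> (F (u s) - F (v s)))) (at s)"
      unfolding has_field_derivative_def
      by (rule has_derivative_eq_rhs[OF has_derivative_inner[OF dz dz]])
        (simp add: fun_eq_iff inner_commute algebra_simps)
    have de: "((\<lambda>s. exp (- 2 * L * (s - t0))) has_real_derivative
        exp (- 2 * L * (s - t0)) * (- 2 * L)) (at s)"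
      by (auto intro!: derivative_eq_intros)
    have dw: "(w has_real_derivative exp (- 2 * L * (s - t0)) *
        (2 * (z s \<bullet> (F (u s) - F (v s))) - 2 * L * (z s \<bullet> z s))) (at s)"
      unfolding w_def
      by (rule DERIV_cong[OF DERIV_mult[OF de dzz]]) (simp add: algebra_simps)
    have us: "u s \<in> S" "v s \<in> S" using S s t by auto
    have "z s \<bullet> (F (u s) - F (v s)) \<le> norm (z s) * norm (F (u s) - F (v s))"
      by (rule norm_cauchy_schwarz)
    also have "\<dots> \<le> norm (z s) * (L * norm (z s))"
      using lipschitz_on_normD[OF L us] by (intro mult_left_mono) (auto simp: z_def)
    also have "\<dots> = L * (z s \<bullet> z s)"
      by (simp add: dot_square_norm power2_eq_square)
    finally have "exp (- 2 * L * (s - t0)) *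
        (2 * (z s \<bullet> (F (u s) - F (v s))) - 2 * L * (z s \<bullet> z s)) \<le> 0"
      by (intro mult_nonneg_nonpos) auto
    then show "\<exists>y. (w has_real_derivative y) (at s) \<and> y \<le> 0" using dw by blast
  qed
  then have "exp (- 2 * L * (t - t0)) * (norm (z t))\<^sup>2 \<le> (norm (z t0))\<^sup>2"
    by (simp add: w_def dot_square_norm)
  then have "exp (2 * L * (t - t0)) * (exp (- 2 * L * (t - t0)) * (norm (z t))\<^sup>2)
      \<le> exp (2 * L * (t - t0)) * (norm (z t0))\<^sup>2"
    by (intro mult_left_mono) auto
  also have "exp (2 * L * (t - t0)) * (exp (- 2 * L * (t - t0)) * (norm (z t))\<^sup>2) = (norm (z t))\<^sup>2"
    by (simp add: mult.assoc[symmetric] exp_add[symmetric])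
  also have "exp (2 * L * (t - t0)) = (exp (L * (t - t0)))\<^sup>2"
    by (simp add: exp_double[symmetric] mult.assoc)
  finally have "(norm (z t))\<^sup>2 \<le> (exp (L * (t - t0)) * norm (z t0))\<^sup>2"
    by (simp add: power_mult_distrib)
  then show ?thesis
    unfolding z_def by (rule power2_le_imp_le) simp
qed

text \<open>The Picard operator is a contraction in the sup norm with factor \<open>L * d\<close>.
  As the Lipschitz bound is global, no ball has to be shown invariant.\<close>

lemma picard_existence:
  fixes F :: "'a::euclidean_space \<Rightarrow> 'a"
  assumes L: "L-lipschitz_on UNIV F" and d: "0 \<le> d" "L * d < 1"
  shows "\<exists>u. u 0 = r \<and> trajectory_on F {0..d} u"
proof -
  have L0: "0 \<le> L" using L by (rule lipschitz_on_nonneg)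
  have contF: "continuous_on UNIV F" using L by (rule lipschitz_on_continuous_on)
  \<comment> \<open>Clamping time to \<open>{0..d}\<close> makes the Picard operator a self-map of
    the complete space of bounded continuous functions on the whole line; its values are constant
    outside \<open>{0..d}\<close>.\<close>
  define c where "c t = max 0 (min d t)" for t :: real
  have c: "c t \<in> {0..d}" for t using d by (auto simp: c_def)
  have contc: "continuous_on UNIV c" unfolding c_def by (intro continuous_intros)
  have contFu: "continuous_on S (\<lambda>s. F (apply_bcontfun u s))" for u :: "real \<Rightarrow>\<^sub>C 'a" and S
    by (rule continuous_on_compose2[OF contF]) auto
  define G where "G u t = r + integral {0..c t} (\<lambda>s. F (apply_bcontfun u s))" for u :: "real \<Rightarrow>\<^sub>C 'a" and t
  have int: "(\<lambda>s. F (apply_bcontfun u s)) integrable_on {a..b}" for u :: "real \<Rightarrow>\<^sub>C 'a" and a b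
    by (rule integrable_continuous_real[OF contFu])
  have icont: "continuous_on {0..d} (\<lambda>t. integral {0..t} (\<lambda>s. F (apply_bcontfun u s)))" for u :: "real \<Rightarrow>\<^sub>C 'a"
    by (rule indefinite_integral_continuous_1[OF int])
  have Gb: "G u \<in> bcontfun" for u
  proof -
    have 1: "continuous_on UNIV (G u)"
      unfolding G_def
      by (intro continuous_intros continuous_on_compose2[OF icont contc]) (use c in auto)
    have "compact ((\<lambda>t. r + integral {0..t} (\<lambda>s. F (apply_bcontfun u s))) ` {0..d})"
      by (intro compact_continuous_image continuous_intros icont) auto
    then have "bounded ((\<lambda>t. r + integral {0..t} (\<lambda>s. F (apply_bcontfun u s))) ` {0..d})"
      by (rule compact_imp_bounded)
    then have "bounded (range (G u))"
      by (rule bounded_subset) (use c in \<open>auto simp: G_def\<close>)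
    with 1 show ?thesis by (simp add: bcontfun_def)
  qed
  define P where "P u = Bcontfun (G u)" for u
  have P: "apply_bcontfun (P u) = G u" for u
    unfolding P_def by (rule Bcontfun_inverse[OF Gb])
  have "\<exists>!u. P u = u"
  proof (rule banach_fix_type)
    show "0 \<le> L * d" using L0 d by simp
    show "L * d < 1" by fact
    show "\<forall>u v. dist (P u) (P v) \<le> L * d * dist u v"
    proof (intro allI dist_bound)
      fix u v :: "real \<Rightarrow>\<^sub>C 'a" and t
      have "dist (P u t) (P v t) = norm (integral {0..c t} (\<lambda>s. F (apply_bcontfun u s))
          - integral {0..c t} (\<lambda>s. F (apply_bcontfun v s)))"
        by (simp add: P G_def dist_norm)
      also have "\<dots> = norm (integral {0..c t} (\<lambda>s. F (apply_bcontfun u s) - F (apply_bcontfun v s)))"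
        by (simp add: integral_diff int)
      also have "\<dots> \<le> (L * dist u v) * (c t - 0)"
      proof (rule integral_bound)
        show "0 \<le> c t" using c[of t] by simp
        show "continuous_on {0..c t} (\<lambda>s. F (apply_bcontfun u s) - F (apply_bcontfun v s))"
          by (intro continuous_intros contFu)
        show "norm (F (apply_bcontfun u s) - F (apply_bcontfun v s)) \<le> L * dist u v" for s
        proof -
          have "norm (F (apply_bcontfun u s) - F (apply_bcontfun v s)) \<le> L * dist (apply_bcontfun u s) (apply_bcontfun v s)"
            using lipschitz_onD[OF L] by (simp add: dist_norm)
          also have "\<dots> \<le> L * dist u v"
            by (intro mult_left_mono dist_bounded L0)
          finally show ?thesis .
        qed
      qed
      also have "\<dots> \<le> (L * dist u v) * d"
        using c[of t] L0 by (intro mult_left_mono) auto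
      finally show "dist (P u t) (P v t) \<le> L * d * dist u v" by (simp add: mult_ac)
    qed
  qed
  then obtain u where u: "P u = u" by blast
  have ut: "u t = r + integral {0..t} (\<lambda>s. F (apply_bcontfun u s))" if "t \<in> {0..d}" for t
  proof -
    have "c t = t" using that by (auto simp: c_def)
    moreover have "apply_bcontfun u = G u" using P[of u] unfolding u .
    ultimately show ?thesis unfolding G_def by metis
  qed
  have "trajectory_on F {0..d} (apply_bcontfun u)"
    unfolding trajectory_on_def
  proof
    fix t assume t: "t \<in> {0..d}"
    have "((\<lambda>t. r + integral {0..t} (\<lambda>s. F (apply_bcontfun u s))) has_vector_derivative F (u t)) (at t within {0..d})"
      using integral_has_vector_derivative[OF contFu[of "{0..d}" u] t]
      by (auto intro!: derivative_eq_intros)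
    then show "(apply_bcontfun u has_vector_derivative F (u t)) (at t within {0..d})"
      using t ut by (metis (no_types, lifting) has_vector_derivative_transform)
  qed
  moreover have "u 0 = r" using ut[of 0] d by simp
  ultimately show ?thesis by blast
qed

lemma trajectory_displacement:
  assumes u: "trajectory_on F {a..b} u" and M: "\<And>s. s \<in> {a..b} \<Longrightarrow> norm (F (u s)) \<le> M"
    and "s \<in> {a..b}" "t \<in> {a..b}"
  shows "norm (u t - u s) \<le> M * \<bar>t - s\<bar>"
proof -
  have "norm (u t - u s) \<le> M * norm (t - s)"
  proof (rule differentiable_bound[where S="{a..b}"])
    fix x assume x: "x \<in> {a..b}"
    show "(u has_derivative (\<lambda>h. h *\<^sub>R F (u x))) (at x within {a..b})"
      using u x by (auto simp: trajectory_on_def has_vector_derivative_def)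
    show "onorm (\<lambda>h. h *\<^sub>R F (u x)) \<le> M"
      by (rule onorm_le) (use M[OF x] in \<open>simp add: mult.commute[of M] mult_left_mono\<close>)
  qed (use assms in auto)
  then show ?thesis by simp
qed

text \<open>Composing \<open>F\<close> with the nearest-point projection onto the ball, which is
  1-Lipschitz, gives a globally Lipschitz, bounded field \<open>G\<close> that agrees with
  \<open>F\<close> on the ball. Its trajectories from the half ball are too slow to leave the ball
  before time \<open>d\<close>.\<close>

lemma local_flow:
  fixes F :: "'a::euclidean_space \<Rightarrow> 'a"
  assumes \<rho>: "\<rho> > 0" and L: "L-lipschitz_on (cball p \<rho>) F"
  obtains d \<phi> where "d > 0"
    "\<And>r. r \<in> ball p (\<rho>/2) \<Longrightarrow> \<phi> r 0 = r"
    "\<And>r. r \<in> ball p (\<rho>/2) \<Longrightarrow> trajectory_on F {0..d} (\<phi> r)"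
    "\<And>r. r \<in> ball p (\<rho>/2) \<Longrightarrow> \<phi> r ` {0..d} \<subseteq> ball p \<rho>"
    "continuous_on (ball p (\<rho>/2) \<times> {0..d}) (\<lambda>(r, t). \<phi> r t)"
proof -
  let ?B = "cball p \<rho>"
  have ne: "?B \<noteq> {}" using \<rho> by auto
  define c where "c = closest_point ?B"
  have cin: "c y \<in> ?B" for y unfolding c_def by (intro closest_point_in_set ne closed_cball)
  have cself: "c y = y" if "y \<in> ?B" for y unfolding c_def using closest_point_self[OF that] .
  have L0: "0 \<le> L" using L by (rule lipschitz_on_nonneg)
  define G where "G y = F (c y)" for y
  have G: "L-lipschitz_on UNIV G"
  proof (rule lipschitz_onI[OF _ L0])
    fix y z
    have "dist (G y) (G z) \<le> L * dist (c y) (c z)"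
      unfolding G_def using L cin by (intro lipschitz_onD) auto
    also have "\<dots> \<le> L * dist y z"
      unfolding c_def by (intro mult_left_mono closest_point_lipschitz L0 ne) auto
    finally show "dist (G y) (G z) \<le> L * dist y z" .
  qed
  have "bounded (F ` ?B)"
    by (intro compact_imp_bounded compact_continuous_image compact_cball lipschitz_on_continuous_on[OF L])
  then obtain M where M: "M > 0" "\<And>y. y \<in> ?B \<Longrightarrow> norm (F y) \<le> M"
    unfolding bounded_pos by auto
  have GM: "norm (G y) \<le> M" for y unfolding G_def using M(2)[OF cin] .
  \<comment> \<open>At speed at most \<open>M\<close>, time \<open>\<rho> / (2 * M)\<close> covers
    at most \<open>\<rho> / 2\<close>; the bound \<open>1 / (L + 1)\<close> ensures
    \<open>L * d < 1\<close> and makes sense for \<open>L = 0\<close> as well.\<close>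
  define d where "d = min (\<rho> / (2 * M)) (1 / (L + 1))"
  have d: "d > 0" using \<rho> M L0 by (auto simp: d_def)
  have "L * d \<le> L * (1 / (L + 1))" unfolding d_def using L0 by (intro mult_left_mono) auto
  also have "\<dots> < 1" using L0 by (simp add: field_simps)
  finally have Ld: "L * d < 1" .
  have "\<forall>r. \<exists>u. u 0 = r \<and> trajectory_on G {0..d} u"
    using picard_existence[OF G _ Ld] d by auto
  then obtain \<phi> where \<phi>: "\<And>r. \<phi> r 0 = r" "\<And>r. trajectory_on G {0..d} (\<phi> r)" by metis
  have Md: "M * d \<le> \<rho> / 2"
  proof -
    have "M * d \<le> M * (\<rho> / (2 * M))" unfolding d_def using M by (intro mult_left_mono) auto
    then show ?thesis using M by simp
  qed
  have stay: "\<phi> r t \<in> ball p \<rho>" if "r \<in> ball p (\<rho>/2)" "t \<in> {0..d}" for r t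
  proof -
    have "norm (\<phi> r t - \<phi> r 0) \<le> M * \<bar>t - 0\<bar>"
      by (rule trajectory_displacement[OF \<phi>(2)]) (use that GM d in auto)
    also have "\<dots> \<le> M * d" using that M by (intro mult_left_mono) auto
    finally have "dist r (\<phi> r t) \<le> \<rho>/2" using Md \<phi>(1) by (simp add: dist_norm norm_minus_commute)
    then show ?thesis using that dist_triangle[of p "\<phi> r t" r] by (simp)
  qed
  have GF: "G y = F y" if "y \<in> ball p \<rho>" for y using that cself[of y] by (auto simp: G_def)
  show ?thesis
  proof
    show "d > 0" by fact
    fix r assume r: "r \<in> ball p (\<rho>/2)"
    show "\<phi> r 0 = r" by (rule \<phi>)
    show "trajectory_on F {0..d} (\<phi> r)"
      by (rule trajectory_on_cong[OF \<phi>(2)[of r]]) (use stay[OF r] GF in auto)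
    show "\<phi> r ` {0..d} \<subseteq> ball p \<rho>" using stay[OF r] by auto
  next
    define K where "K = exp (L * d)"
    \<comment> \<open>The time variable contributes the speed bound \<open>M\<close>, the starting
      point the Gronwall factor \<open>K\<close>.\<close>
    have "(M + K)-lipschitz_on (ball p (\<rho>/2) \<times> {0..d}) (\<lambda>(r, t). \<phi> r t)"
    proof (rule lipschitz_onI)
      show "0 \<le> M + K" using M by (simp add: K_def)
      fix a b assume a: "a \<in> ball p (\<rho>/2) \<times> {0..d}" and b: "b \<in> ball p (\<rho>/2) \<times> {0..d}"
      obtain r t where ar: "a = (r, t)" by (cases a)
      obtain q s where bq: "b = (q, s)" by (cases b)
      have t: "t \<in> {0..d}" and s: "s \<in> {0..d}" using a b by (auto simp: ar bq)
      have 1: "norm (\<phi> r t - \<phi> r s) \<le> M * dist t s"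
        using trajectory_displacement[OF \<phi>(2)[of r], of M s t] GM t s by (simp add: dist_real_def)
      have "norm (\<phi> r s - \<phi> q s) \<le> exp (L * (s - 0)) * norm (\<phi> r 0 - \<phi> q 0)"
        by (rule trajectory_gronwall[OF \<phi>(2) \<phi>(2) G]) (use s in auto)
      also have "\<dots> = exp (L * s) * dist r q" by (simp add: \<phi>(1) dist_norm)
      also have "\<dots> \<le> K * dist r q"
        unfolding K_def using s L0 by (intro mult_right_mono) (auto intro: mult_left_mono)
      finally have 2: "norm (\<phi> r s - \<phi> q s) \<le> K * dist r q" .
      have "dist (\<phi> r t) (\<phi> q s) \<le> norm (\<phi> r t - \<phi> r s) + norm (\<phi> r s - \<phi> q s)"
        by (metis dist_norm dist_triangle)
      also have "\<dots> \<le> M * dist t s + K * dist r q" using 1 2 by simp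
      also have "\<dots> \<le> M * dist a b + K * dist a b"
        using dist_snd_le[of a b] dist_fst_le[of a b] M
        by (intro add_mono mult_left_mono) (auto simp: ar bq K_def)
      finally show "dist (case a of (r, t) \<Rightarrow> \<phi> r t) (case b of (r, t) \<Rightarrow> \<phi> r t) \<le> (M + K) * dist a b"
        by (simp add: ar bq algebra_simps)
    qed
    then show "continuous_on (ball p (\<rho>/2) \<times> {0..d}) (\<lambda>(r, t). \<phi> r t)"
      by (rule lipschitz_on_continuous_on)
  qed
qed

section \<open>Lipschitz bounds and gradients of smooth functions\<close>

lemma smooth_on_has_derivative:
  assumes "smooth_on U f" "y \<in> U"
  shows "(f has_derivative frechet_derivative f (at y)) (at y)"
proof -
  have "Ck_on (Suc 0) U f" using assms(1) by (simp add: smooth_on_def)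
  then show ?thesis using assms(2) frechet_derivative_works by auto
qed

lemma smooth_on_continuous_frechet_derivative:
  assumes "smooth_on U f"
  shows "continuous_on U (\<lambda>y. frechet_derivative f (at y) v)"
proof -
  have "Ck_on (Suc 0) U f" using assms(1) by (simp add: smooth_on_def)
  then show ?thesis by simp
qed

lemma smooth_on_continuous_on: "smooth_on U f \<Longrightarrow> continuous_on U f"
  using Ck_on.simps(1) smooth_on_def by blast

text \<open>\<open>Ck_on\<close> yields continuity only of each directional derivative separately.
  Bounds for the finitely many directions in \<open>Basis\<close> on the compact ball bound the
  operator norm, and the mean value inequality applies because the ball is convex.\<close>

lemma smooth_on_lipschitz_cball:
  fixes f :: "'a::euclidean_space \<Rightarrow> 'b::real_normed_vector"
  assumes f: "smooth_on U f" and sub: "cball p \<rho> \<subseteq> U"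
  obtains L where "L-lipschitz_on (cball p \<rho>) f"
proof -
  let ?D = "\<lambda>y. frechet_derivative f (at y)"
  have "\<exists>B. \<forall>y\<in>cball p \<rho>. norm (?D y i) \<le> B" for i
  proof -
    have "bounded ((\<lambda>y. ?D y i) ` cball p \<rho>)"
      by (intro compact_imp_bounded compact_continuous_image compact_cball
          continuous_on_subset[OF smooth_on_continuous_frechet_derivative[OF f] sub])
    then show ?thesis by (auto simp: bounded_iff)
  qed
  then obtain B where B: "\<And>i y. y \<in> cball p \<rho> \<Longrightarrow> norm (?D y i) \<le> B i" by metis
  \<comment> \<open>The absolute value gives a nonnegative constant without any argument about the
    signs of the \<open>B i\<close>.\<close>
  define L where "L = \<bar>\<Sum>i\<in>Basis. B i\<bar>"
  have on: "onorm (?D y) \<le> L" if y: "y \<in> cball p \<rho>" for y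
  proof (rule onorm_le)
    fix v
    have lin: "linear (?D y)"
      using smooth_on_has_derivative[OF f] y sub by (meson has_derivative_linear subsetD)
    have "norm (?D y v) = norm (\<Sum>i\<in>Basis. (v \<bullet> i) *\<^sub>R ?D y i)"
      by (subst euclidean_representation[of v, symmetric]) (simp add: linear_sum[OF lin] linear_scale[OF lin])
    also have "\<dots> \<le> (\<Sum>i\<in>Basis. norm v * B i)"
    proof (rule sum_norm_le)
      fix i :: 'a assume i: "i \<in> Basis"
      show "norm ((v \<bullet> i) *\<^sub>R ?D y i) \<le> norm v * B i"
        using Basis_le_norm[OF i, of v] B[OF y, of i] by (auto intro!: mult_mono)
    qed
    also have "\<dots> = norm v * (\<Sum>i\<in>Basis. B i)" by (simp add: sum_distrib_left)
    also have "\<dots> \<le> norm v * L" unfolding L_def by (intro mult_left_mono) auto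
    finally show "norm (?D y v) \<le> L * norm v" by (simp add: mult.commute)
  qed
  have "L-lipschitz_on (cball p \<rho>) f"
  proof (rule lipschitz_onI)
    fix y z assume "y \<in> cball p \<rho>" "z \<in> cball p \<rho>"
    then have "norm (f y - f z) \<le> L * norm (y - z)"
      by (intro differentiable_bound[where S="cball p \<rho>" and f'="?D"] on)
        (use sub in \<open>auto intro!: has_derivative_at_withinI smooth_on_has_derivative[OF f]\<close>)
    then show "dist (f y) (f z) \<le> L * dist y z" by (simp add: dist_norm)
  qed (simp add: L_def)
  then show ?thesis by (rule that)
qed

text \<open>\<open>gradient\<close> is a definite description, so a representing vector (assembled
  from the partial derivatives) must be exhibited and shown to be unique before anything can be said
  about it.\<close>

lemma has_derivative_gradient:
  fixes f :: "'a::euclidean_space \<Rightarrow> real"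
  assumes "smooth_on U f" "q \<in> U"
  shows "(f has_derivative (\<lambda>v. v \<bullet> gradient f q)) (at q)"
proof -
  let ?D = "frechet_derivative f (at q)"
  have d: "(f has_derivative ?D) (at q)" using assms by (rule smooth_on_has_derivative)
  then have lin: "linear ?D" by (rule has_derivative_linear)
  define g where "g = (\<Sum>i\<in>Basis. ?D i *\<^sub>R i)"
  have "?D v = v \<bullet> g" for v
  proof -
    have "?D v = ?D (\<Sum>i\<in>Basis. (v \<bullet> i) *\<^sub>R i)" by (simp add: euclidean_representation)
    also have "\<dots> = (\<Sum>i\<in>Basis. (v \<bullet> i) * ?D i)"
      by (simp add: linear_sum[OF lin] linear_scale[OF lin])
    also have "\<dots> = v \<bullet> g" by (simp add: g_def inner_sum_right mult.commute)
    finally show ?thesis .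
  qed
  then have "?D = (\<lambda>v. v \<bullet> g)" by auto
  then have g: "GDERIV f q :> g" using d by (simp add: gderiv_def)
  have "gradient f q = g"
    unfolding gradient_def
  proof (rule the_equality)
    show "GDERIV f q :> g" by (rule g)
    fix g' assume "GDERIV f q :> g'"
    then have "(\<lambda>v. v \<bullet> g') = (\<lambda>v. v \<bullet> g)"
      using g unfolding gderiv_def by (rule has_derivative_unique)
    then have "\<forall>v. v \<bullet> g' = v \<bullet> g" by (simp add: fun_eq_iff)
    then show "g' = g" using vector_eq_ldot[of g' g] by (simp add: inner_commute)
  qed
  then show ?thesis using g by (simp add: gderiv_def)
qed

lemma continuous_on_gradient:
  fixes f :: "'a::euclidean_space \<Rightarrow> real"
  assumes f: "smooth_on U f"
  shows "continuous_on U (gradient f)"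
proof -
  have "continuous_on U (\<lambda>q. gradient f q \<bullet> i)" for i
  proof -
    have "frechet_derivative f (at q) i = gradient f q \<bullet> i" if "q \<in> U" for q
      by (simp add: frechet_derivative_at[OF has_derivative_gradient[OF f that], symmetric] inner_commute)
    then show ?thesis
      by (rule continuous_on_eq[OF smooth_on_continuous_frechet_derivative[OF f, of i]])
  qed
  then show ?thesis by (subst continuous_on_componentwise) blast
qed

section \<open>Geometry near a crossing point\<close>

text \<open>By the chain rule \<open>H\<close> has derivative \<open>D (u s) (F (u s))\<close> along
  \<open>u\<close>. It is in this monotone form that transversality is used for the hitting
  time.\<close>

lemma increasing_along_trajectory:
  assumes u: "trajectory_on F {a..b} u"
    and H: "\<And>s. s \<in> {a..b} \<Longrightarrow> (H has_derivative D (u s)) (at (u s))"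
    and pos: "\<And>s. s \<in> {a..b} \<Longrightarrow> D (u s) (F (u s)) > (0::real)"
    and st: "a \<le> s" "s < t" "t \<le> b"
  shows "H (u s) < H (u t)"
proof -
  have d: "((\<lambda>s. H (u s)) has_real_derivative D (u r) (F (u r))) (at r within {a..b})"
    if r: "r \<in> {a..b}" for r
  proof -
    have "(u has_vector_derivative F (u r)) (at r within {a..b})"
      using u r by (auto simp: trajectory_on_def)
    then have 1: "(u has_derivative (\<lambda>h. h *\<^sub>R F (u r))) (at r within {a..b})"
      by (simp add: has_vector_derivative_def)
    have "((\<lambda>s. H (u s)) has_derivative (\<lambda>h. D (u r) (h *\<^sub>R F (u r)))) (at r within {a..b})"
      by (rule has_derivative_compose[OF 1 H[OF r]])
    moreover have "D (u r) (h *\<^sub>R F (u r)) = D (u r) (F (u r)) * h" for h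
      using linear_scale[OF has_derivative_linear[OF H[OF r]]] by simp
    ultimately show ?thesis by (simp add: has_field_derivative_def)
  qed
  show ?thesis
  proof (rule DERIV_pos_imp_increasing_open[OF st(2)])
    fix r assume r: "s < r" "r < t"
    then have "at r within {a..b} = at r" using st by (intro at_within_Icc_at) auto
    then show "\<exists>y. ((\<lambda>s. H (u s)) has_real_derivative y) (at r) \<and> y > 0"
      using d[of r] pos[of r] r st by auto
  next
    have "continuous_on {a..b} (\<lambda>s. H (u s))"
      using d by (meson DERIV_continuous continuous_on_eq_continuous_within)
    then show "continuous_on {s..t} (\<lambda>s. H (u s))"
      by (rule continuous_on_subset) (use st in auto)
  qed
qed

text \<open>A segment is a trajectory of the constant field \<open>v\<close>; the distance condition
  keeps all of it in the ball where \<open>D y v\<close> is positive.\<close>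

lemma increasing_along_line:
  assumes H: "\<And>y. y \<in> ball p \<rho> \<Longrightarrow> (H has_derivative D y) (at y)"
    and v: "\<And>y. y \<in> ball p \<rho> \<Longrightarrow> D y v > (0::real)"
    and t: "0 < t" and q: "dist p q + t * norm v < \<rho>"
  shows "H q < H (q + t *\<^sub>R v)"
proof -
  have 1: "trajectory_on (\<lambda>_. v) {0..t} (\<lambda>s. q + s *\<^sub>R v)"
    unfolding trajectory_on_def by (auto intro!: derivative_eq_intros)
  have 2: "q + s *\<^sub>R v \<in> ball p \<rho>" if "s \<in> {0..t}" for s
  proof -
    have "dist p (q + s *\<^sub>R v) \<le> dist p q + dist q (q + s *\<^sub>R v)" by (rule dist_triangle)
    also have "\<dots> = dist p q + s * norm v" using that by (simp add: dist_norm)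
    also have "\<dots> \<le> dist p q + t * norm v" using that by (intro add_left_mono mult_right_mono) auto
    finally show ?thesis using q by simp
  qed
  have "H (q + 0 *\<^sub>R v) < H (q + t *\<^sub>R v)"
    by (rule increasing_along_trajectory[OF 1, where D = D]) (use H v 2 t in auto)
  then show ?thesis by simp
qed

text \<open>The zero set of \<open>H\<close> is not straightened. Sliding along \<open>v\<close>
  only increases \<open>H\<close>, so every nearby point with \<open>H > 0\<close> is joined inside
  \<open>S\<close> to one small ball around \<open>w\<close>, the point \<open>p\<close> pushed off
  along \<open>v\<close>; hence a single component contains all of them. A zero of \<open>H\<close>
  becomes positive after an arbitrarily short slide and so lies in the closure.\<close>

lemma positive_side_in_component:
  fixes H :: "'a::real_normed_vector \<Rightarrow> real"
  assumes \<rho>: "\<rho> > 0" and p: "H p = 0"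
    and H: "\<And>y. y \<in> ball p \<rho> \<Longrightarrow> (H has_derivative D y) (at y)"
    and v: "\<And>y. y \<in> ball p \<rho> \<Longrightarrow> D y v > 0"
    and S: "\<And>y. y \<in> ball p \<rho> \<Longrightarrow> H y > 0 \<Longrightarrow> y \<in> S"
  obtains \<epsilon> C where "0 < \<epsilon>" "\<epsilon> \<le> \<rho>" "C \<in> components S"
    "\<And>q. q \<in> ball p \<epsilon> \<Longrightarrow> H q > 0 \<Longrightarrow> q \<in> C"
    "\<And>q. q \<in> ball p \<epsilon> \<Longrightarrow> H q = 0 \<Longrightarrow> q \<in> closure C"
proof -
  \<comment> \<open>The slide has length below \<open>\<rho> / 2\<close>, so that it stays in
    \<open>ball p \<rho>\<close> when it starts within \<open>\<rho> / 2\<close> of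
    \<open>p\<close>.\<close>
  define \<eta> where "\<eta> = \<rho> / (2 * (norm v + 1))"
  have nv: "norm v + 1 > 0" by (metis add.commute norm_ge_zero add_pos_nonneg zero_less_one)
  have \<eta>: "\<eta> > 0" using \<rho> nv by (simp add: \<eta>_def)
  have \<eta>v: "\<eta> * norm v < \<rho> / 2"
  proof -
    have "\<eta> * norm v < \<eta> * (norm v + 1)" using \<eta> by simp
    also have "\<dots> = \<rho> / 2" using nv unfolding \<eta>_def by (simp add: field_simps)
    finally show ?thesis .
  qed
  define w where "w = p + \<eta> *\<^sub>R v"
  have wd: "dist p w < \<rho> / 2" using \<eta>v \<eta> by (simp add: w_def dist_norm)
  have Hw: "H w > 0"
    using increasing_along_line[of p \<rho> H D v \<eta> p, OF H v \<eta>] \<eta>v \<rho> p by (simp add: w_def)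
  have "isCont H w" using H[of w] wd \<rho> by (intro has_derivative_continuous) auto
  then obtain \<epsilon>1 where \<epsilon>1: "\<epsilon>1 > 0" "\<And>y. dist y w < \<epsilon>1 \<Longrightarrow> dist (H y) (H w) < H w"
    using Hw unfolding continuous_at_eps_delta by blast
  have Hpos: "H y > 0" if "y \<in> ball w \<epsilon>1" for y
    using \<epsilon>1(2)[of y] that by (auto simp: dist_commute dist_real_def)
  \<comment> \<open>Sliding carries \<open>ball p \<epsilon>\<close> onto
    \<open>ball w \<epsilon>\<close>: \<open>\<epsilon>1\<close> keeps the target where
    \<open>H\<close> is positive, \<open>\<rho> / 2\<close> leaves room for the slide.\<close>
  define \<epsilon> where "\<epsilon> = min \<epsilon>1 (\<rho> / 2)"
  have \<epsilon>: "0 < \<epsilon>" "\<epsilon> \<le> \<epsilon>1" "\<epsilon> \<le> \<rho> / 2" using \<epsilon>1 \<rho> by (auto simp: \<epsilon>_def)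
  have ballw: "ball w \<epsilon> \<subseteq> S"
  proof
    fix y assume y: "y \<in> ball w \<epsilon>"
    then have "y \<in> ball p \<rho>" using wd \<epsilon> dist_triangle[of p y w] by auto
    moreover have "H y > 0" using y \<epsilon> by (intro Hpos) auto
    ultimately show "y \<in> S" by (rule S)
  qed
  let ?C = "connected_component_set S w"
  have C: "?C \<in> components S" using ballw \<epsilon> by (intro componentsI) auto
  have in_C: "q \<in> ?C" if q: "q \<in> ball p \<epsilon>" and Hq: "H q > 0" for q
  proof -
    let ?q = "q + \<eta> *\<^sub>R v"
    have "closed_segment q ?q \<subseteq> S"
    proof
      fix y assume "y \<in> closed_segment q ?q"
      then obtain s where s: "0 \<le> s" "s \<le> 1" "y = q + (s * \<eta>) *\<^sub>R v"
        by (auto simp: closed_segment_image_interval algebra_simps)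
      have "s * \<eta> * norm v \<le> 1 * (\<eta> * norm v)"
        unfolding mult.assoc using s \<eta> by (intro mult_right_mono) auto
      then have le: "dist p q + (s * \<eta>) * norm v < \<rho>" using q \<epsilon> \<eta>v by auto
      have "H y > 0"
      proof (cases "s = 0")
        case False
        then have "H q < H y" unfolding s(3)
          by (intro increasing_along_line[of p \<rho> H D v, OF H v _ le]) (use s \<eta> in auto)
        then show ?thesis using Hq by simp
      qed (use s Hq in simp)
      moreover have "y \<in> ball p \<rho>"
      proof -
        have "dist p y \<le> dist p q + dist q y" by (rule dist_triangle)
        then show ?thesis using le s \<eta> by (simp add: dist_norm)
      qed
      ultimately show "y \<in> S" by (intro S)
    qed
    then have 1: "connected_component S q ?q"
      unfolding connected_component_def by (intro exI[of _ "closed_segment q ?q"]) auto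
    have "?q \<in> ball w \<epsilon>" using q by (simp add: w_def dist_norm)
    then have 2: "connected_component S w ?q"
      using ballw \<epsilon> unfolding connected_component_def by (intro exI[of _ "ball w \<epsilon>"]) auto
    show ?thesis using connected_component_trans[OF 2 connected_component_sym[OF 1]] by simp
  qed
  have cl: "q \<in> closure ?C" if q: "q \<in> ball p \<epsilon>" and Hq: "H q = 0" for q
    unfolding closure_approachable
  proof (intro allI impI)
    fix e :: real assume e: "e > 0"
    define \<mu> where "\<mu> = min e (\<epsilon> - dist p q)"
    have \<mu>: "\<mu> > 0" "\<mu> \<le> e" "\<mu> \<le> \<epsilon> - dist p q" using e q by (auto simp: \<mu>_def)
    \<comment> \<open>This slide is shorter than both \<open>e\<close> and the distance left to the
      boundary of \<open>ball p \<epsilon>\<close>, so \<open>in_C\<close> applies at its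
      end.\<close>
    define t where "t = \<mu> / (2 * (norm v + 1))"
    have t: "t > 0" using \<mu> nv by (simp add: t_def)
    have "t * norm v < t * (norm v + 1)" using t by simp
    also have "\<dots> = \<mu> / 2" using nv unfolding t_def by (simp add: field_simps)
    finally have tv: "t * norm v < e" "t * norm v < \<epsilon> - dist p q" using \<mu> by linarith+
    let ?y = "q + t *\<^sub>R v"
    have "H q < H ?y" by (rule increasing_along_line[of p \<rho> H D v, OF H v t]) (use tv \<epsilon> \<rho> in auto)
    moreover have "dist p ?y \<le> dist p q + t * norm v"
      using dist_triangle[of p ?y q] t by (simp add: dist_norm)
    then have "?y \<in> ball p \<epsilon>" using tv by simp
    ultimately have "?y \<in> ?C" using Hq by (intro in_C) auto
    moreover have "dist ?y q < e" using tv t by (simp add: dist_norm)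
    ultimately show "\<exists>y\<in>?C. dist y q < e" by blast
  qed
  show ?thesis by (rule that[OF _ _ C in_C cl]) (use \<epsilon> \<rho> in auto)
qed

section \<open>The components of the complement of the switching set, and charts at crossing
  points\<close>

locale piecewise_field =
  fixes N :: nat and h :: "nat \<Rightarrow> real ^ 'n \<Rightarrow> real" and k :: nat
    and A :: "nat \<Rightarrow> (real ^ 'n) set" and X :: "nat \<Rightarrow> real ^ 'n \<Rightarrow> real ^ 'n"
  assumes field: "piecewise_smooth_field N h k A X"
begin

abbreviation \<Sigma> :: "(real ^ 'n) set" where "\<Sigma> \<equiv> switching_set N h"
abbreviation crossing :: "real ^ 'n \<Rightarrow> bool" where "crossing \<equiv> crossing_point N h k A X"

lemma smooth_h: "i \<in> {1..N} \<Longrightarrow> smooth_on UNIV (h i)"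
  using field by (auto simp: piecewise_smooth_field_def)

lemma closed_zero_set: "i \<in> {1..N} \<Longrightarrow> closed (h i -` {0})"
  by (rule closed_vimage[OF closed_singleton smooth_on_continuous_on[OF smooth_h]])

lemma closed_switching_set: "closed \<Sigma>"
  unfolding switching_set_def using closed_zero_set by (intro closed_UN) auto

lemma A_bij: "bij_betw A {1..k} (components (- \<Sigma>))"
  using field by (simp add: piecewise_smooth_field_def)

lemma A_component: "j \<in> {1..k} \<Longrightarrow> A j \<in> components (- \<Sigma>)"
  using A_bij by (auto simp: bij_betw_def)

lemma A_open: "j \<in> {1..k} \<Longrightarrow> open (A j)"
  using A_component closed_switching_set open_components by (metis open_Compl)

lemma A_subset: "j \<in> {1..k} \<Longrightarrow> A j \<subseteq> - \<Sigma>"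
  using A_component in_components_subset by blast

lemma component_index: "C \<in> components (- \<Sigma>) \<Longrightarrow> \<exists>j\<in>{1..k}. C = A j"
  using A_bij by (auto simp: bij_betw_def)

lemma A_cover: "q \<notin> \<Sigma> \<Longrightarrow> \<exists>j\<in>{1..k}. q \<in> A j"
  using component_index Union_components[of "- \<Sigma>"] by (metis ComplI UnionE)

lemma A_disjoint:
  assumes "i \<in> {1..k}" "j \<in> {1..k}" "q \<in> A i" "q \<in> A j"
  shows "i = j"
proof -
  have "A i = A j"
    using components_nonoverlap[OF A_component[OF assms(1)] A_component[OF assms(2)]] assms(3,4)
    by blast
  then show ?thesis by (rule inj_onD[OF bij_betw_imp_inj_on[OF A_bij] _ assms(1,2)])
qed

lemma A_closure:
  assumes "i \<in> {1..k}" "j \<in> {1..k}" "q \<in> A i" "q \<in> closure (A j)"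
  shows "i = j"
proof -
  have "A i \<inter> A j \<noteq> {}"
    using assms A_open[OF assms(1)] open_Int_closure_eq_empty by blast
  then show ?thesis using A_disjoint[OF assms(1,2)] by blast
qed

lemma smooth_X:
  assumes "j \<in> {1..k}"
  obtains U where "open U" "closure (A j) \<subseteq> U" "smooth_on U (X j)"
  using field assms unfolding piecewise_smooth_field_def by blast

lemma isCont_X: "j \<in> {1..k} \<Longrightarrow> q \<in> closure (A j) \<Longrightarrow> isCont (X j) q"
  by (metis smooth_X smooth_on_continuous_on continuous_on_eq_continuous_at subsetD)

lemma X_local_lipschitz:
  assumes "j \<in> {1..k}" "q \<in> closure (A j)"
  obtains \<rho> L where "\<rho> > 0" "L-lipschitz_on (cball q \<rho>) (X j)"
proof -
  obtain U where U: "open U" "closure (A j) \<subseteq> U" "smooth_on U (X j)"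
    using smooth_X[OF assms(1)] .
  then obtain \<rho> where "\<rho> > 0" "cball q \<rho> \<subseteq> U" using assms(2) open_contains_cball by blast
  then show ?thesis using smooth_on_lipschitz_cball[OF U(3)] that by metis
qed

text \<open>\<open>H\<close> is the switching function through \<open>p\<close>, with its sign chosen so that both adjacent fields
  point towards \<open>H > 0\<close>; thus \<open>a\<close> is the incoming and \<open>b\<close> the outgoing component.\<close>

definition crossing_chart ::
  "real ^ 'n \<Rightarrow> real \<Rightarrow> (real ^ 'n \<Rightarrow> real) \<Rightarrow> (real ^ 'n \<Rightarrow> real ^ 'n \<Rightarrow> real) \<Rightarrow> nat \<Rightarrow> nat \<Rightarrow> bool"
where
  "crossing_chart p \<rho> H D a b \<longleftrightarrow>
     \<rho> > 0 \<and> a \<in> {1..k} \<and> b \<in> {1..k} \<and> a \<noteq> b \<and> H p = 0 \<and>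
     (\<forall>q\<in>ball p \<rho>. (H has_derivative D q) (at q) \<and> D q (X a q) > 0 \<and> D q (X b q) > 0 \<and>
        (H q > 0 \<longrightarrow> q \<in> A b) \<and> (H q < 0 \<longrightarrow> q \<in> A a) \<and>
        (H q = 0 \<longrightarrow> q \<in> \<Sigma> \<and> crossing q \<and> q \<in> closure (A a) \<inter> closure (A b)))"

text \<open>Being a crossing point is an open condition along the switching set. This persistence is
  what allows orbits that start nearby to be solutions as well.\<close>

lemma crossing_chart_exists:
  assumes "crossing p"
  obtains \<rho> H D a b where "crossing_chart p \<rho> H D a b"
proof -
  from assms obtain i a0 b0 where i: "i \<in> {1..N}" "h i p = 0"
    and uniq: "\<And>i'. i' \<in> {1..N} \<Longrightarrow> h i' p = 0 \<Longrightarrow> i' = i"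
    and grad: "gradient (h i) p \<noteq> 0"
    and ab0: "a0 \<noteq> b0" "{j\<in>{1..k}. p \<in> closure (A j)} = {a0, b0}"
    and prod: "(X a0 p \<bullet> gradient (h i) p) * (X b0 p \<bullet> gradient (h i) p) > 0"
    unfolding crossing_point_def by blast
  have a0: "a0 \<in> {1..k}" "p \<in> closure (A a0)" and b0: "b0 \<in> {1..k}" "p \<in> closure (A b0)"
    using ab0(2) by blast+
  define g where "g = gradient (h i)"
  \<comment> \<open>The two inner products in the crossing condition have the same nonzero sign, so
    one common factor makes \<open>H\<close> increase along both fields.\<close>
  define \<sigma> where "\<sigma> = sgn (X a0 p \<bullet> g p)"
  define H where "H q = \<sigma> * h i q" for q
  define D where "D q v = \<sigma> * (v \<bullet> g q)" for q v
  \<comment> \<open>The sliding direction for \<open>positive_side_in_component\<close>;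
    \<open>D p v0\<close> is the squared norm of the gradient at \<open>p\<close>.\<close>
  define v0 where "v0 = \<sigma> *\<^sub>R g p"
  have \<sigma>: "\<sigma> \<noteq> 0" "\<sigma> * \<sigma> = 1"
    using prod by (auto simp: \<sigma>_def g_def sgn_if)
  have H0: "H q = 0 \<longleftrightarrow> h i q = 0" for q using \<sigma> by (simp add: H_def)
  have der: "(H has_derivative D q) (at q)" for q
    unfolding H_def D_def g_def
    by (intro has_derivative_mult_right has_derivative_gradient[OF smooth_h[OF i(1)]]) simp
  have contg: "isCont g p"
    unfolding g_def using continuous_on_gradient[OF smooth_h[OF i(1)]]
    by (simp add: continuous_on_eq_continuous_at)
  have posp: "D p v0 > 0" "D p (X a0 p) > 0" "D p (X b0 p) > 0"
  proof -
    have "D p v0 = \<sigma> * \<sigma> * (g p \<bullet> g p)" by (simp add: D_def v0_def)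
    then show "D p v0 > 0" using \<sigma> grad by (simp add: g_def)
    have "X a0 p \<bullet> g p > 0 \<and> X b0 p \<bullet> g p > 0 \<or> X a0 p \<bullet> g p < 0 \<and> X b0 p \<bullet> g p < 0"
      using prod by (auto simp: g_def zero_less_mult_iff)
    then show "D p (X a0 p) > 0" "D p (X b0 p) > 0" by (auto simp: D_def \<sigma>_def)
  qed
  \<comment> \<open>All four conditions hold at \<open>p\<close> and are open. The last one keeps
    the other switching functions away from 0, so that near \<open>p\<close> the switching set is
    the zero set of \<open>H\<close>.\<close>
  have "\<forall>\<^sub>F q in nhds p. D q v0 > 0 \<and> D q (X a0 q) > 0 \<and> D q (X b0 q) > 0
      \<and> q \<notin> (\<Union>i'\<in>{1..N}-{i}. h i' -` {0})"
  proof (intro eventually_conj)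
    have lim: "(g \<longlongrightarrow> g p) (nhds p)" "(X a0 \<longlongrightarrow> X a0 p) (nhds p)" "(X b0 \<longlongrightarrow> X b0 p) (nhds p)"
      using contg isCont_X[OF a0] isCont_X[OF b0] by (simp_all add: continuous_at tendsto_at_iff_tendsto_nhds)
    show "\<forall>\<^sub>F q in nhds p. D q v0 > 0"
      by (rule order_tendstoD(1)[OF _ posp(1)]) (auto simp: D_def intro!: tendsto_intros lim)
    show "\<forall>\<^sub>F q in nhds p. D q (X a0 q) > 0"
      by (rule order_tendstoD(1)[OF _ posp(2)]) (auto simp: D_def intro!: tendsto_intros lim)
    show "\<forall>\<^sub>F q in nhds p. D q (X b0 q) > 0"
      by (rule order_tendstoD(1)[OF _ posp(3)]) (auto simp: D_def intro!: tendsto_intros lim)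
    have "closed (\<Union>i'\<in>{1..N}-{i}. h i' -` {0})" using closed_zero_set by (intro closed_UN) auto
    moreover have "p \<notin> (\<Union>i'\<in>{1..N}-{i}. h i' -` {0})" using uniq by auto
    ultimately have "\<forall>\<^sub>F q in nhds p. q \<in> - (\<Union>i'\<in>{1..N}-{i}. h i' -` {0})"
      by (intro eventually_nhds_in_open open_Compl) (simp_all only: Compl_iff not_False_eq_True)
    then show "\<forall>\<^sub>F q in nhds p. q \<notin> (\<Union>i'\<in>{1..N}-{i}. h i' -` {0})"
      by (simp only: Compl_iff)
  qed
  then obtain \<rho> where \<rho>: "\<rho> > 0"
    and near: "\<And>q. q \<in> ball p \<rho> \<Longrightarrow> D q v0 > 0" "\<And>q. q \<in> ball p \<rho> \<Longrightarrow> D q (X a0 q) > 0"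
      "\<And>q. q \<in> ball p \<rho> \<Longrightarrow> D q (X b0 q) > 0"
      "\<And>q. q \<in> ball p \<rho> \<Longrightarrow> q \<notin> (\<Union>i'\<in>{1..N}-{i}. h i' -` {0})"
    unfolding eventually_nhds_metric by (auto simp: dist_commute)
  have \<Sigma>H: "q \<in> \<Sigma> \<longleftrightarrow> H q = 0" if "q \<in> ball p \<rho>" for q
    using near(4)[OF that] i(1) by (auto simp: switching_set_def H0)
  have Hp: "H p = 0" using i by (simp add: H0)
  obtain \<epsilon>1 C1 where C1: "0 < \<epsilon>1" "\<epsilon>1 \<le> \<rho>" "C1 \<in> components (- \<Sigma>)"
    "\<And>q. q \<in> ball p \<epsilon>1 \<Longrightarrow> H q > 0 \<Longrightarrow> q \<in> C1"
    "\<And>q. q \<in> ball p \<epsilon>1 \<Longrightarrow> H q = 0 \<Longrightarrow> q \<in> closure C1"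
    by (rule positive_side_in_component[of \<rho> H p D v0 "- \<Sigma>"])
      (use \<rho> Hp der near(1) \<Sigma>H in \<open>auto simp del: mem_ball\<close>)
  obtain \<epsilon>2 C2 where C2: "0 < \<epsilon>2" "\<epsilon>2 \<le> \<rho>" "C2 \<in> components (- \<Sigma>)"
    "\<And>q. q \<in> ball p \<epsilon>2 \<Longrightarrow> - H q > 0 \<Longrightarrow> q \<in> C2"
    "\<And>q. q \<in> ball p \<epsilon>2 \<Longrightarrow> - H q = 0 \<Longrightarrow> q \<in> closure C2"
  \<comment> \<open>The negative side is the positive side of \<open>- H\<close>, with the opposite
    sliding direction.\<close>
  proof (rule positive_side_in_component[of \<rho> "\<lambda>q. - H q" p "\<lambda>q v. - D q v" "- v0" "- \<Sigma>"])
    show "((\<lambda>q. - H q) has_derivative (\<lambda>v. - D q v)) (at q)" for q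
      by (rule has_derivative_minus[OF der])
    show "- D q (- v0) > 0" if "q \<in> ball p \<rho>" for q
      using near(1)[OF that] by (simp add: D_def)
  qed (use \<rho> Hp \<Sigma>H in \<open>auto simp del: mem_ball\<close>)
  obtain b where b: "b \<in> {1..k}" "C1 = A b" using component_index[OF C1(3)] by blast
  obtain a where a: "a \<in> {1..k}" "C2 = A a" using component_index[OF C2(3)] by blast
  define \<epsilon> where "\<epsilon> = min \<epsilon>1 \<epsilon>2"
  have \<epsilon>: "\<epsilon> > 0" "ball p \<epsilon> \<subseteq> ball p \<epsilon>1" "ball p \<epsilon> \<subseteq> ball p \<epsilon>2" "ball p \<epsilon> \<subseteq> ball p \<rho>"
    using C1(1,2) C2(1) by (auto simp: \<epsilon>_def)
  have pos: "q \<in> A b" if "q \<in> ball p \<epsilon>" "H q > 0" for q using C1(4) that \<epsilon> b by blast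
  have neg: "q \<in> A a" if "q \<in> ball p \<epsilon>" "H q < 0" for q using C2(4) that \<epsilon> a by force
  have zero: "q \<in> closure (A a) \<inter> closure (A b)" if "q \<in> ball p \<epsilon>" "H q = 0" for q
    using C1(5)[of q] C2(5)[of q] that \<epsilon> a b by auto
  \<comment> \<open>A component with \<open>q\<close> in its closure meets the ball, and off the
    switching set the ball is covered by \<open>A a\<close> and \<open>A b\<close>.\<close>
  have adj: "{j\<in>{1..k}. q \<in> closure (A j)} = {a, b}" if q: "q \<in> ball p \<epsilon>" "H q = 0" for q
  proof
    show "{a, b} \<subseteq> {j\<in>{1..k}. q \<in> closure (A j)}" using zero[OF q] a b by auto
    show "{j\<in>{1..k}. q \<in> closure (A j)} \<subseteq> {a, b}"
    proof
      fix j assume "j \<in> {j\<in>{1..k}. q \<in> closure (A j)}"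
      then have j: "j \<in> {1..k}" "q \<in> closure (A j)" by auto
      then have "ball p \<epsilon> \<inter> A j \<noteq> {}"
        using q(1) open_Int_closure_eq_empty[of "ball p \<epsilon>" "A j"] by blast
      then obtain y where y: "y \<in> ball p \<epsilon>" "y \<in> A j" by blast
      then have "H y \<noteq> 0" using \<Sigma>H[of y] A_subset[OF j(1)] \<epsilon>(4) by blast
      then consider "H y > 0" | "H y < 0" by linarith
      then show "j \<in> {a, b}"
        using pos[OF y(1)] neg[OF y(1)] A_disjoint[OF j(1)] a(1) b(1) y(2) by cases blast+
    qed
  qed
  \<comment> \<open>Adjacency at \<open>p\<close> identifies the two sides with the components of
    the crossing condition, which also yields that \<open>a\<close> and \<open>b\<close>
    differ.\<close>
  have "{a, b} = {a0, b0}" using adj[of p] ab0(2) \<epsilon>(1) Hp by simp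
  then have ab: "a \<noteq> b" "a \<in> {a0, b0}" "b \<in> {a0, b0}" using ab0(1) by auto
  have posab: "D q (X a q) > 0" "D q (X b q) > 0" if "q \<in> ball p \<epsilon>" for q
    using that near(2,3) ab(2,3) \<epsilon>(4) by blast+
  have cross: "crossing q" if q: "q \<in> ball p \<epsilon>" "H q = 0" for q
    unfolding crossing_point_def
  proof (intro bexI[OF _ i(1)] conjI exI)
    have q\<rho>: "q \<in> ball p \<rho>" using q \<epsilon> by blast
    show "h i q = 0" using q H0 by simp
    show "\<forall>i'\<in>{1..N}. h i' q = 0 \<longrightarrow> i' = i" using near(4)[OF q\<rho>] by auto
    show "gradient (h i) q \<noteq> 0" using near(1)[OF q\<rho>] by (auto simp: D_def g_def)
    show "a \<noteq> b" by fact
    show "{j \<in> {1..k}. q \<in> closure (A j)} = {a, b}" by (rule adj[OF q])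
    show "X a q \<bullet> gradient (h i) q * (X b q \<bullet> gradient (h i) q) > 0"
      using posab[OF q(1)] by (auto simp: D_def g_def[symmetric] zero_less_mult_iff)
  qed
  have "crossing_chart p \<epsilon> H D a b"
    unfolding crossing_chart_def
  proof (intro conjI ballI impI)
    fix q assume q: "q \<in> ball p \<epsilon>"
    show "q \<in> \<Sigma>" if "H q = 0" using \<Sigma>H q that \<epsilon>(4) by blast
    show "D q (X a q) > 0" "D q (X b q) > 0" using posab[OF q] by auto
    show "q \<in> A b" if "H q > 0" using pos[OF q that] .
    show "q \<in> A a" if "H q < 0" using neg[OF q that] .
    show "crossing q" if "H q = 0" using cross[OF q that] .
    show "q \<in> closure (A a) \<inter> closure (A b)" if "H q = 0" using zero[OF q that] .
  qed (use \<epsilon>(1) a(1) b(1) ab(1) Hp der in auto)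
  then show ?thesis by (rule that)
qed

end

section \<open>Solutions of the piecewise smooth field\<close>

text \<open>Needed because \<open>frechet_derivative\<close> is unspecified where no derivative
  exists: the formula for the derivative of a negated function is available only on
  \<open>S\<close>, and the induction over the order must get by with equality there.\<close>

lemma Ck_on_cong_open:
  assumes "open S" "Ck_on m S f" "\<And>y. y \<in> S \<Longrightarrow> f y = g y"
  shows "Ck_on m S g"
  using assms(2,3)
proof (induction m arbitrary: f g)
  case 0
  then show ?case by (simp cong: continuous_on_cong)
next
  case (Suc m)
  have d: "(g has_derivative frechet_derivative f (at y)) (at y)" if y: "y \<in> S" for y
  proof (rule has_derivative_transform_within_open[OF _ assms(1) y])
    show "(f has_derivative frechet_derivative f (at y)) (at y)"
      using Suc.prems(1) y frechet_derivative_works by auto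
  qed (use Suc.prems in auto)
  have "Ck_on m S (\<lambda>y. frechet_derivative g (at y) v)" for v
  proof (rule Suc.IH)
    show "Ck_on m S (\<lambda>y. frechet_derivative f (at y) v)" using Suc.prems(1) by simp
    show "frechet_derivative f (at y) v = frechet_derivative g (at y) v" if "y \<in> S" for y
      using frechet_derivative_at[OF d[OF that]] by simp
  qed
  moreover have "\<forall>y\<in>S. g differentiable (at y)" using d differentiableI by blast
  ultimately show ?case by simp
qed

lemma Ck_on_uminus:
  assumes "open S" "Ck_on m S f"
  shows "Ck_on m S (\<lambda>y. - f y)"
  using assms(2)
proof (induction m arbitrary: f)
  case 0
  then show ?case by (simp add: continuous_on_minus)
next
  case (Suc m)
  have d: "((\<lambda>y. - f y) has_derivative (\<lambda>v. - frechet_derivative f (at y) v)) (at y)" if "y \<in> S" for y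
    using Suc.prems that frechet_derivative_works by (intro has_derivative_minus) auto
  have "Ck_on m S (\<lambda>y. frechet_derivative (\<lambda>y. - f y) (at y) v)" for v
  proof (rule Ck_on_cong_open[OF assms(1) Suc.IH])
    show "Ck_on m S (\<lambda>y. frechet_derivative f (at y) v)" using Suc.prems by simp
    show "- frechet_derivative f (at y) v = frechet_derivative (\<lambda>y. - f y) (at y) v" if "y \<in> S" for y
      using frechet_derivative_at[OF d[OF that]] by (metis (no_types))
  qed
  moreover have "\<forall>y\<in>S. (\<lambda>y. - f y) differentiable (at y)" using d differentiableI by blast
  ultimately show ?case by simp
qed

lemma smooth_on_uminus: "open S \<Longrightarrow> smooth_on S f \<Longrightarrow> smooth_on S (\<lambda>y. - f y)"
  using Ck_on_uminus by (auto simp: smooth_on_def)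

text \<open>One-sided germ of a trajectory. The equation is imposed at time \<open>t\<close> too,
  where the curve may lie on the switching set, whereas membership in \<open>S\<close> concerns only
  interior times.\<close>

definition departs ::
  "('a::real_normed_vector \<Rightarrow> 'a) \<Rightarrow> 'a set \<Rightarrow> (real \<Rightarrow> 'a) \<Rightarrow> real \<Rightarrow> bool" where
  "departs F S \<gamma> t \<longleftrightarrow> (\<exists>\<epsilon>>0. trajectory_on F {t..t + \<epsilon>} \<gamma> \<and> \<gamma> ` {t<..<t + \<epsilon>} \<subseteq> S)"

definition arrives ::
  "('a::real_normed_vector \<Rightarrow> 'a) \<Rightarrow> 'a set \<Rightarrow> (real \<Rightarrow> 'a) \<Rightarrow> real \<Rightarrow> bool" where
  "arrives F S \<gamma> t \<longleftrightarrow> (\<exists>\<epsilon>>0. trajectory_on F {t - \<epsilon>..t} \<gamma> \<and> \<gamma> ` {t - \<epsilon><..<t} \<subseteq> S)"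

lemma departsE:
  assumes "departs F S \<gamma> t" "e > 0"
  obtains \<epsilon> where "0 < \<epsilon>" "\<epsilon> \<le> e" "trajectory_on F {t..t + \<epsilon>} \<gamma>" "\<gamma> ` {t<..<t + \<epsilon>} \<subseteq> S"
proof -
  obtain \<epsilon> where \<epsilon>: "\<epsilon> > 0" "trajectory_on F {t..t + \<epsilon>} \<gamma>" "\<gamma> ` {t<..<t + \<epsilon>} \<subseteq> S"
    using assms(1) by (auto simp: departs_def)
  have "trajectory_on F {t..t + min \<epsilon> e} \<gamma>" by (rule trajectory_on_subset[OF \<epsilon>(2)]) auto
  moreover have "\<gamma> ` {t<..<t + min \<epsilon> e} \<subseteq> S" using \<epsilon>(3) by fastforce
  ultimately show ?thesis using that[of "min \<epsilon> e"] \<epsilon>(1) assms(2) by auto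
qed

lemma departs_reverse:
  assumes "departs F S \<gamma> (c - t)"
  shows "arrives (\<lambda>y. - F y) S (\<lambda>s. \<gamma> (c - s)) t"
proof -
  obtain \<epsilon> where \<epsilon>: "\<epsilon> > 0" "trajectory_on F {c - t..c - t + \<epsilon>} \<gamma>" "\<gamma> ` {c - t<..<c - t + \<epsilon>} \<subseteq> S"
    using assms by (auto simp: departs_def)
  have "trajectory_on (\<lambda>y. - F y) {t - \<epsilon>..t} (\<lambda>s. \<gamma> (c - s))"
    by (rule trajectory_on_reverse[OF \<epsilon>(2)]) auto
  moreover have "(\<lambda>s. \<gamma> (c - s)) ` {t - \<epsilon><..<t} \<subseteq> S"
  proof (rule image_subsetI)
    fix s assume "s \<in> {t - \<epsilon><..<t}"
    then have "c - s \<in> {c - t<..<c - t + \<epsilon>}" by auto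
    then show "\<gamma> (c - s) \<in> S" using \<epsilon>(3) by blast
  qed
  ultimately show ?thesis using \<epsilon>(1) by (auto simp: arrives_def)
qed

lemma arrives_reverse:
  assumes "arrives F S \<gamma> (c - t)"
  shows "departs (\<lambda>y. - F y) S (\<lambda>s. \<gamma> (c - s)) t"
proof -
  obtain \<epsilon> where \<epsilon>: "\<epsilon> > 0" "trajectory_on F {c - t - \<epsilon>..c - t} \<gamma>" "\<gamma> ` {c - t - \<epsilon><..<c - t} \<subseteq> S"
    using assms by (auto simp: arrives_def)
  have "trajectory_on (\<lambda>y. - F y) {t..t + \<epsilon>} (\<lambda>s. \<gamma> (c - s))"
    by (rule trajectory_on_reverse[OF \<epsilon>(2)]) auto
  moreover have "(\<lambda>s. \<gamma> (c - s)) ` {t<..<t + \<epsilon>} \<subseteq> S"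
  proof (rule image_subsetI)
    fix s assume "s \<in> {t<..<t + \<epsilon>}"
    then have "c - s \<in> {c - t - \<epsilon><..<c - t}" by auto
    then show "\<gamma> (c - s) \<in> S" using \<epsilon>(3) by blast
  qed
  ultimately show ?thesis using \<epsilon>(1) by (auto simp: departs_def)
qed

text \<open>Lets a statement about departures be deduced from its counterpart about arrivals for the
  negated field.\<close>

lemma departs_uminus_iff: "departs F S \<gamma> t \<longleftrightarrow> arrives (\<lambda>y. - F y) S (\<lambda>s. \<gamma> (- s)) (- t)"
  using departs_reverse[of F S \<gamma> 0 "- t"] arrives_reverse[of "\<lambda>y. - F y" S "\<lambda>s. \<gamma> (- s)" 0 t] by auto

lemma arrivesE:
  assumes "arrives F S \<gamma> t" "e > 0"
  obtains \<epsilon> where "0 < \<epsilon>" "\<epsilon> \<le> e" "trajectory_on F {t - \<epsilon>..t} \<gamma>" "\<gamma> ` {t - \<epsilon><..<t} \<subseteq> S"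
proof -
  obtain \<epsilon> where \<epsilon>: "\<epsilon> > 0" "trajectory_on F {t - \<epsilon>..t} \<gamma>" "\<gamma> ` {t - \<epsilon><..<t} \<subseteq> S"
    using assms(1) by (auto simp: arrives_def)
  have "trajectory_on F {t - min \<epsilon> e..t} \<gamma>" by (rule trajectory_on_subset[OF \<epsilon>(2)]) auto
  moreover have "\<gamma> ` {t - min \<epsilon> e<..<t} \<subseteq> S" using \<epsilon>(3) by fastforce
  ultimately show ?thesis using that[of "min \<epsilon> e"] \<epsilon>(1) assms(2) by auto
qed

lemma departs_cong:
  assumes "departs F S \<gamma> t" "e > 0" "\<And>s. t \<le> s \<Longrightarrow> s \<le> t + e \<Longrightarrow> \<gamma>' s = \<gamma> s"
  shows "departs F S \<gamma>' t"
proof -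
  obtain \<epsilon> where \<epsilon>: "0 < \<epsilon>" "\<epsilon> \<le> e" "trajectory_on F {t..t + \<epsilon>} \<gamma>" "\<gamma> ` {t<..<t + \<epsilon>} \<subseteq> S"
    using departsE[OF assms(1,2)] .
  have "trajectory_on F {t..t + \<epsilon>} \<gamma>'" by (rule trajectory_on_cong[OF \<epsilon>(3)]) (use assms(3) \<epsilon> in auto)
  moreover have "\<gamma>' ` {t<..<t + \<epsilon>} = \<gamma> ` {t<..<t + \<epsilon>}" by (rule image_cong) (use assms(3) \<epsilon> in auto)
  ultimately show ?thesis using \<epsilon> by (auto simp: departs_def)
qed

lemma arrives_cong:
  assumes "arrives F S \<gamma> t" "e > 0" "\<And>s. t - e \<le> s \<Longrightarrow> s \<le> t \<Longrightarrow> \<gamma>' s = \<gamma> s"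
  shows "arrives F S \<gamma>' t"
proof -
  obtain \<epsilon> where \<epsilon>: "0 < \<epsilon>" "\<epsilon> \<le> e" "trajectory_on F {t - \<epsilon>..t} \<gamma>" "\<gamma> ` {t - \<epsilon><..<t} \<subseteq> S"
    using arrivesE[OF assms(1,2)] .
  have "trajectory_on F {t - \<epsilon>..t} \<gamma>'" by (rule trajectory_on_cong[OF \<epsilon>(3)]) (use assms(3) \<epsilon> in auto)
  moreover have "\<gamma>' ` {t - \<epsilon><..<t} = \<gamma> ` {t - \<epsilon><..<t}" by (rule image_cong) (use assms(3) \<epsilon> in auto)
  ultimately show ?thesis using \<epsilon> by (auto simp: arrives_def)
qed

lemma departs_shift:
  assumes "departs F S \<gamma> (t + d)"
  shows "departs F S (\<lambda>s. \<gamma> (s + d)) t"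
proof -
  obtain \<epsilon> where \<epsilon>: "\<epsilon> > 0" "trajectory_on F {t + d..t + d + \<epsilon>} \<gamma>" "\<gamma> ` {t + d<..<t + d + \<epsilon>} \<subseteq> S"
    using assms by (auto simp: departs_def)
  have "trajectory_on F {t..t + \<epsilon>} (\<lambda>s. \<gamma> (s + d))" by (rule trajectory_on_shift[OF \<epsilon>(2)]) auto
  moreover have "(\<lambda>s. \<gamma> (s + d)) ` {t<..<t + \<epsilon>} \<subseteq> S"
  proof (rule image_subsetI)
    fix s assume "s \<in> {t<..<t + \<epsilon>}"
    then have "s + d \<in> {t + d<..<t + d + \<epsilon>}" by auto
    then show "\<gamma> (s + d) \<in> S" using \<epsilon>(3) by blast
  qed
  ultimately show ?thesis using \<epsilon>(1) by (auto simp: departs_def)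
qed

lemma arrives_shift:
  assumes "arrives F S \<gamma> (t + d)"
  shows "arrives F S (\<lambda>s. \<gamma> (s + d)) t"
proof -
  obtain \<epsilon> where \<epsilon>: "\<epsilon> > 0" "trajectory_on F {t + d - \<epsilon>..t + d} \<gamma>" "\<gamma> ` {t + d - \<epsilon><..<t + d} \<subseteq> S"
    using assms by (auto simp: arrives_def)
  have "trajectory_on F {t - \<epsilon>..t} (\<lambda>s. \<gamma> (s + d))" by (rule trajectory_on_shift[OF \<epsilon>(2)]) auto
  moreover have "(\<lambda>s. \<gamma> (s + d)) ` {t - \<epsilon><..<t} \<subseteq> S"
  proof (rule image_subsetI)
    fix s assume "s \<in> {t - \<epsilon><..<t}"
    then have "s + d \<in> {t + d - \<epsilon><..<t + d}" by auto
    then show "\<gamma> (s + d) \<in> S" using \<epsilon>(3) by blast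
  qed
  ultimately show ?thesis using \<epsilon>(1) by (auto simp: arrives_def)
qed

lemma departs_tendsto: "departs F S \<gamma> t \<Longrightarrow> (\<gamma> \<longlongrightarrow> \<gamma> t) (at_right t)"
  unfolding departs_def using trajectory_on_continuous continuous_on_Icc_at_rightD
  by (metis less_add_same_cancel1)

lemma arrives_tendsto: "arrives F S \<gamma> t \<Longrightarrow> (\<gamma> \<longlongrightarrow> \<gamma> t) (at_left t)"
  unfolding arrives_def using trajectory_on_continuous continuous_on_Icc_at_leftD
  by (metis diff_less_eq less_add_same_cancel1)

lemma departs_closure:
  assumes "departs F S \<gamma> t"
  shows "\<gamma> t \<in> closure S"
proof -
  obtain \<epsilon> where \<epsilon>: "\<epsilon> > 0" "\<gamma> ` {t<..<t + \<epsilon>} \<subseteq> S"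
    using assms by (auto simp: departs_def)
  have "\<forall>\<^sub>F s in at_right t. \<gamma> s \<in> closure S"
    unfolding eventually_at_right_field
    using \<epsilon> closure_subset[of S] by (intro exI[of _ "t + \<epsilon>"]) (auto simp: image_subset_iff)
  then show ?thesis
    by (intro Lim_in_closed_set[OF closed_closure _ _ departs_tendsto[OF assms]]) auto
qed

lemma arrives_closure:
  assumes "arrives F S \<gamma> t"
  shows "\<gamma> t \<in> closure S"
  using departs_closure[OF arrives_reverse[of F S \<gamma> 0 "- t"]] assms by simp

text \<open>Glues the two one-sided derivatives at a time when the arriving and the departing field
  coincide.\<close>

lemma has_vector_derivative_Un:
  assumes "(f has_vector_derivative v) (at t within S)" "(f has_vector_derivative v) (at t within S')"
  shows "(f has_vector_derivative v) (at t within (S \<union> S'))"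
  using assms unfolding has_vector_derivative_def has_derivative_within
  by (simp add: at_within_union filterlim_sup)

section \<open>Time reversal, and the forced direction at crossing points\<close>

context piecewise_field
begin

text \<open>Time reversal becomes a second instance of the locale with the same switching functions
  and components, so each lemma of the locale comes with its time-reversed companion.\<close>

lemma reversed: "piecewise_field N h k A (\<lambda>j y. - X j y)"
proof
  have "\<exists>U. open U \<and> closure (A j) \<subseteq> U \<and> smooth_on U (\<lambda>y. - X j y)" if "j \<in> {1..k}" for j
    using smooth_X[OF that] smooth_on_uminus by metis
  then show "piecewise_smooth_field N h k A (\<lambda>j y. - X j y)"
    using field unfolding piecewise_smooth_field_def by blast
qed

lemma crossing_reversed: "crossing_point N h k A (\<lambda>j y. - X j y) p \<longleftrightarrow> crossing p"
  by (simp add: crossing_point_def)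

text \<open>The negated fields point towards \<open>H < 0\<close>. Hence \<open>- H\<close> is the
  function that increases, and incoming and outgoing component trade places.\<close>

lemma crossing_chart_reversed:
  assumes "crossing_chart p \<rho> H D a b"
  shows "piecewise_field.crossing_chart N h k A (\<lambda>j y. - X j y) p \<rho> (\<lambda>q. - H q) (\<lambda>q v. - D q v) b a"
proof -
  interpret rev: piecewise_field N h k A "\<lambda>j y. - X j y" by (rule reversed)
  have *: "D q (- X j q) = - D q (X j q)" if "q \<in> ball p \<rho>" for q j
  proof -
    have "(H has_derivative D q) (at q)" using assms that by (auto simp: crossing_chart_def)
    then show ?thesis by (metis has_derivative_linear linear_neg)
  qed
  show ?thesis
    using assms unfolding crossing_chart_def rev.crossing_chart_def
    by (simp add: * crossing_reversed has_derivative_minus del: mem_ball)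
qed

text \<open>If \<open>j\<close> were not the incoming component, then near \<open>p\<close> the set
  \<open>A j\<close> would lie on the side \<open>H > 0\<close> and \<open>j\<close> would be
  \<open>b\<close>. But \<open>X b\<close> pushes \<open>H\<close> upwards at \<open>p\<close>, so
  \<open>H\<close> must be negative just before the arrival.\<close>

lemma arrives_crossing:
  assumes c: "crossing_chart p \<rho> H D a b" and j: "j \<in> {1..k}"
    and arr: "arrives (X j) (A j) \<gamma> t" and p: "\<gamma> t = p"
  shows "j = a"
proof (rule ccontr)
  assume "j \<noteq> a"
  have \<rho>: "\<rho> > 0" and ab: "a \<in> {1..k}" "b \<in> {1..k}" and Hp: "H p = 0"
    and der: "(H has_derivative D p) (at p)" and Db: "D p (X b p) > 0"
    and pos: "\<And>q. q \<in> ball p \<rho> \<Longrightarrow> H q > 0 \<Longrightarrow> q \<in> A b"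
    and neg: "\<And>q. q \<in> ball p \<rho> \<Longrightarrow> H q < 0 \<Longrightarrow> q \<in> A a"
    and zero: "\<And>q. q \<in> ball p \<rho> \<Longrightarrow> H q = 0 \<Longrightarrow> q \<in> \<Sigma>"
    using c by (auto simp: crossing_chart_def)
  have Aj: "y \<in> A b \<and> b = j \<and> H y > 0" if y: "y \<in> ball p \<rho>" "y \<in> A j" for y
  proof -
    have "H y \<noteq> 0" using zero[OF y(1)] A_subset[OF j] y(2) by blast
    moreover have "\<not> H y < 0"
      using neg[OF y(1)] A_disjoint[OF ab(1) j _ y(2)] \<open>j \<noteq> a\<close> by blast
    ultimately have "H y > 0" by linarith
    then show ?thesis using pos[OF y(1)] A_disjoint[OF ab(2) j _ y(2)] by blast
  qed
  obtain \<epsilon> where \<epsilon>: "\<epsilon> > 0" "trajectory_on (X j) {t - \<epsilon>..t} \<gamma>" "\<gamma> ` {t - \<epsilon><..<t} \<subseteq> A j"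
    using arr by (auto simp: arrives_def)
  have "\<forall>\<^sub>F s in at_left t. \<gamma> s \<in> ball p \<rho>"
    using topological_tendstoD[OF arrives_tendsto[OF arr], of "ball p \<rho>"] p \<rho> by auto
  then obtain t' where t': "t' < t" "\<And>s. t' < s \<Longrightarrow> s < t \<Longrightarrow> \<gamma> s \<in> ball p \<rho>"
    unfolding eventually_at_left_field by blast
  have right: "b = j \<and> H (\<gamma> s) > 0" if "max t' (t - \<epsilon>) < s" "s < t" for s
  proof -
    have "\<gamma> s \<in> A j" using \<epsilon>(3) that by (auto simp: image_subset_iff)
    moreover have "\<gamma> s \<in> ball p \<rho>" using t'(2) that by simp
    ultimately show ?thesis using Aj by blast
  qed
  obtain s0 where "max t' (t - \<epsilon>) < s0" "s0 < t"
    using t'(1) \<epsilon>(1) dense[of "max t' (t - \<epsilon>)" t] by auto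
  then have bj: "b = j" using right by blast
  have "(\<gamma> has_vector_derivative X j p) (at t within {t - \<epsilon>..t})"
    using \<epsilon>(1,2) p by (auto simp: trajectory_on_def)
  then have 1: "(\<gamma> has_derivative (\<lambda>r. r *\<^sub>R X j p)) (at t within {t - \<epsilon>..t})"
    by (simp add: has_vector_derivative_def)
  have "((\<lambda>s. H (\<gamma> s)) has_derivative (\<lambda>r. D p (r *\<^sub>R X j p))) (at t within {t - \<epsilon>..t})"
    by (rule has_derivative_compose[OF 1]) (use der p in simp)
  moreover have "D p (r *\<^sub>R X j p) = D p (X j p) * r" for r
    using linear_scale[OF has_derivative_linear[OF der]] by simp
  ultimately have "((\<lambda>s. H (\<gamma> s)) has_real_derivative D p (X j p)) (at t within {t - \<epsilon>..t})"
    by (simp add: has_field_derivative_def)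
  \<comment> \<open>Only the derivative at the single time \<open>t\<close> is used: a positive left
    derivative forces smaller values just before.\<close>
  from has_real_derivative_pos_inc_left[OF this] Db bj
  obtain d where d: "d > 0" "\<And>r. r > 0 \<Longrightarrow> t - r \<in> {t - \<epsilon>..t} \<Longrightarrow> r < d \<Longrightarrow> H (\<gamma> (t - r)) < H (\<gamma> t)"
    by blast
  define r where "r = min (d / 2) (min ((t - t') / 2) (\<epsilon> / 2))"
  have r: "r > 0" "r < d" "r < t - t'" "r < \<epsilon>"
    using d(1) t'(1) \<epsilon>(1) by (auto simp: r_def min_less_iff_disj)
  have "H (\<gamma> (t - r)) < 0" using d(2)[of r] r p Hp by auto
  moreover have "H (\<gamma> (t - r)) > 0" using right[of "t - r"] r by auto
  ultimately show False by simp
qed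

lemma departs_crossing:
  assumes c: "crossing_chart p \<rho> H D a b" and j: "j \<in> {1..k}"
    and dep: "departs (X j) (A j) \<gamma> t" and p: "\<gamma> t = p"
  shows "j = b"
proof -
  interpret rev: piecewise_field N h k A "\<lambda>j y. - X j y" by (rule reversed)
  show ?thesis
    by (rule rev.arrives_crossing[OF crossing_chart_reversed[OF c] j, of "\<lambda>s. \<gamma> (- s)" "- t"])
      (use dep p departs_uminus_iff in auto)
qed

lemma departs_interior:
  assumes "i \<in> {1..k}" "\<gamma> t \<in> A i" "j \<in> {1..k}" "departs (X j) (A j) \<gamma> t"
  shows "j = i"
  using A_closure[OF assms(1,3,2) departs_closure[OF assms(4)]] by simp

lemma arrives_interior:
  assumes "i \<in> {1..k}" "\<gamma> t \<in> A i" "j \<in> {1..k}" "arrives (X j) (A j) \<gamma> t"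
  shows "j = i"
  using A_closure[OF assms(1,3,2) arrives_closure[OF assms(4)]] by simp

text \<open>The outgoing component is determined by the position alone, whatever the curve did
  before. Uniqueness of solutions across the switching set rests on this.\<close>

lemma departs_unique:
  assumes "\<gamma> t \<in> \<Sigma> \<longrightarrow> crossing (\<gamma> t)" "\<gamma> t = \<gamma>' t" "i \<in> {1..k}" "j \<in> {1..k}"
    "departs (X i) (A i) \<gamma> t" "departs (X j) (A j) \<gamma>' t"
  shows "i = j"
proof (cases "\<gamma> t \<in> \<Sigma>")
  case True
  then obtain \<rho> H D a b where "crossing_chart (\<gamma> t) \<rho> H D a b"
    using assms(1) crossing_chart_exists by metis
  then have "i = b" "j = b" using departs_crossing assms by metis+
  then show ?thesis by simp
next
  case False
  then obtain l where "l \<in> {1..k}" "\<gamma> t \<in> A l" using A_cover by blast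
  then show ?thesis using departs_interior assms by metis
qed

section \<open>Solutions described by one-sided germs\<close>

text \<open>An equivalent of \<open>solution_on\<close> whose conditions at different times are local and
  one-sided, so that it is stable under restriction, concatenation and time reversal.\<close>

definition local_solution :: "real \<Rightarrow> (real \<Rightarrow> real ^ 'n) \<Rightarrow> bool" where
  "local_solution T \<gamma> \<longleftrightarrow>
     (\<forall>t\<in>{0..T}. \<gamma> t \<in> \<Sigma> \<longrightarrow> crossing (\<gamma> t)) \<and>
     (\<forall>t\<in>{0..<T}. \<exists>j\<in>{1..k}. departs (X j) (A j) \<gamma> t) \<and>
     (\<forall>t\<in>{0<..T}. \<exists>j\<in>{1..k}. arrives (X j) (A j) \<gamma> t)"

lemma local_solution_departs:
  assumes "local_solution T \<gamma>" "0 \<le> t" "t < T"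
  obtains j where "j \<in> {1..k}" "departs (X j) (A j) \<gamma> t"
proof -
  have "t \<in> {0..<T}" using assms by simp
  then show ?thesis using assms(1) that unfolding local_solution_def by blast
qed

lemma local_solution_arrives:
  assumes "local_solution T \<gamma>" "0 < t" "t \<le> T"
  obtains j where "j \<in> {1..k}" "arrives (X j) (A j) \<gamma> t"
proof -
  have "t \<in> {0<..T}" using assms by simp
  then show ?thesis using assms(1) that unfolding local_solution_def by blast
qed

lemma local_solution_restrict:
  assumes "local_solution T \<gamma>" "0 \<le> s" "s + T' \<le> T"
  shows "local_solution T' (\<lambda>t. \<gamma> (t + s))"
  unfolding local_solution_def
proof (intro conjI ballI)
  show "\<gamma> (t + s) \<in> \<Sigma> \<longrightarrow> crossing (\<gamma> (t + s))" if "t \<in> {0..T'}" for t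
    using assms that by (simp add: local_solution_def)
  show "\<exists>j\<in>{1..k}. departs (X j) (A j) (\<lambda>t. \<gamma> (t + s)) t" if "t \<in> {0..<T'}" for t
  proof -
    have "t + s \<in> {0..<T}" using that assms by auto
    then show ?thesis using assms(1) departs_shift unfolding local_solution_def by blast
  qed
  show "\<exists>j\<in>{1..k}. arrives (X j) (A j) (\<lambda>t. \<gamma> (t + s)) t" if "t \<in> {0<..T'}" for t
  proof -
    have "t + s \<in> {0<..T}" using that assms by auto
    then show ?thesis using assms(1) arrives_shift unfolding local_solution_def by blast
  qed
qed

lemma local_solution_reverse:
  assumes "local_solution T \<gamma>"
  shows "piecewise_field.local_solution N h k A (\<lambda>j y. - X j y) T (\<lambda>t. \<gamma> (T - t))"
proof -
  interpret rev: piecewise_field N h k A "\<lambda>j y. - X j y" by (rule reversed)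
  show ?thesis
    unfolding rev.local_solution_def crossing_reversed
  proof (intro conjI ballI)
    show "\<gamma> (T - t) \<in> \<Sigma> \<longrightarrow> crossing (\<gamma> (T - t))" if "t \<in> {0..T}" for t
      using assms that by (simp add: local_solution_def)
    show "\<exists>j\<in>{1..k}. departs (\<lambda>y. - X j y) (A j) (\<lambda>t. \<gamma> (T - t)) t" if "t \<in> {0..<T}" for t
    proof -
      have "T - t \<in> {0<..T}" using that by auto
      then show ?thesis using assms arrives_reverse unfolding local_solution_def by blast
    qed
    show "\<exists>j\<in>{1..k}. arrives (\<lambda>y. - X j y) (A j) (\<lambda>t. \<gamma> (T - t)) t" if "t \<in> {0<..T}" for t
    proof -
      have "T - t \<in> {0..<T}" using that by auto
      then show ?thesis using assms departs_reverse unfolding local_solution_def by blast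
    qed
  qed
qed

text \<open>Arrival and departure at the seam are separate conditions, so equal values there
  suffice; that the two fields fit together at a crossing point is automatic by
  \<open>arrives_crossing\<close> and \<open>departs_crossing\<close>.\<close>

lemma local_solution_concat:
  assumes 1: "local_solution T1 \<gamma>1" and 2: "local_solution T2 \<gamma>2"
    and T: "0 \<le> T1" "0 \<le> T2" and eq: "\<gamma>1 T1 = \<gamma>2 0"
  shows "local_solution (T1 + T2) (\<lambda>t. if t \<le> T1 then \<gamma>1 t else \<gamma>2 (t - T1))"
    (is "local_solution _ ?\<gamma>")
proof -
  have sh: "?\<gamma> s = \<gamma>2 (s + - T1)" if "T1 \<le> s" for s using that eq by auto
  show ?thesis
    unfolding local_solution_def
  proof (intro conjI ballI)
    fix t assume t: "t \<in> {0..T1 + T2}"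
    show "?\<gamma> t \<in> \<Sigma> \<longrightarrow> crossing (?\<gamma> t)"
    proof (cases "t \<le> T1")
      case True
      then show ?thesis using 1 t by (simp add: local_solution_def)
    next
      case False
      then have "t - T1 \<in> {0..T2}" using t by auto
      then show ?thesis using 2 False by (simp add: local_solution_def)
    qed
  next
    fix t assume t: "t \<in> {0..<T1 + T2}"
    show "\<exists>j\<in>{1..k}. departs (X j) (A j) ?\<gamma> t"
    \<comment> \<open>Strict here, weak in the case of arrivals: at the seam the departure is that
      of \<open>\<gamma>2\<close> and the arrival that of \<open>\<gamma>1\<close>.\<close>
    proof (cases "t < T1")
      case True
      obtain j where j: "j \<in> {1..k}" "departs (X j) (A j) \<gamma>1 t"
        by (rule local_solution_departs[OF 1, of t]) (use t True in auto)
      have "departs (X j) (A j) ?\<gamma> t" by (rule departs_cong[OF j(2), of "T1 - t"]) (use True in auto)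
      then show ?thesis using j(1) by blast
    next
      case False
      then have "t + - T1 \<in> {0..<T2}" using t by auto
      then obtain j where j: "j \<in> {1..k}" "departs (X j) (A j) \<gamma>2 (t + - T1)"
        using 2 unfolding local_solution_def by blast
      have "departs (X j) (A j) ?\<gamma> t"
        by (rule departs_cong[OF departs_shift[OF j(2)], of 1], simp, rule sh, use False in linarith)
      then show ?thesis using j(1) by blast
    qed
  next
    fix t assume t: "t \<in> {0<..T1 + T2}"
    show "\<exists>j\<in>{1..k}. arrives (X j) (A j) ?\<gamma> t"
    proof (cases "t \<le> T1")
      case True
      obtain j where j: "j \<in> {1..k}" "arrives (X j) (A j) \<gamma>1 t"
        by (rule local_solution_arrives[OF 1, of t]) (use t True in auto)
      have "arrives (X j) (A j) ?\<gamma> t" by (rule arrives_cong[OF j(2), of 1]) (use True in auto)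
      then show ?thesis using j(1) by blast
    next
      case False
      then have "t + - T1 \<in> {0<..T2}" using t by auto
      then obtain j where j: "j \<in> {1..k}" "arrives (X j) (A j) \<gamma>2 (t + - T1)"
        using 2 unfolding local_solution_def by blast
      have "arrives (X j) (A j) ?\<gamma> t"
        by (rule arrives_cong[OF arrives_shift[OF j(2)], of "t - T1"]) (use False sh in auto)
      then show ?thesis using j(1) by blast
    qed
  qed
qed

section \<open>Equivalence of the local description with \<open>solution_on\<close>\<close>

lemma local_solution_continuous:
  assumes "local_solution T \<gamma>"
  shows "continuous_on {0..T} \<gamma>"
proof (cases "0 < T")
  case True
  show ?thesis
    unfolding continuous_on_def
  proof
    fix t assume t: "t \<in> {0..T}"
    have r: "(\<gamma> \<longlongrightarrow> \<gamma> t) (at_right t)" if "t < T"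
      by (rule local_solution_departs[OF assms, of t]) (use t that departs_tendsto in auto)
    have l: "(\<gamma> \<longlongrightarrow> \<gamma> t) (at_left t)" if "0 < t"
      by (rule local_solution_arrives[OF assms, of t]) (use t that arrives_tendsto in auto)
    consider "t = 0" | "t = T" | "0 < t" "t < T" using t by fastforce
    then show "(\<gamma> \<longlongrightarrow> \<gamma> t) (at t within {0..T})"
    proof cases
      case 1 then show ?thesis using r True by (simp add: at_within_Icc_at_right)
    next
      case 2 then show ?thesis using l True by (simp add: at_within_Icc_at_left)
    next
      case 3 then show ?thesis using r l filterlim_split_at by (metis at_within_Icc_at)
    qed
  qed
next
  case False
  then have "{0..T} \<subseteq> {0}" by auto
  then show ?thesis using continuous_on_sing continuous_on_subset by blast
qed

text \<open>The open set \<open>A j\<close> misses the closures of the other components, so only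
  \<open>X j\<close> can depart from or arrive at one of its points, and the one-sided derivatives
  fit together.\<close>

lemma local_solution_has_vector_derivative:
  assumes sol: "local_solution T \<gamma>" and t: "t \<in> {0..T}" and j: "j \<in> {1..k}" "\<gamma> t \<in> A j"
  shows "(\<gamma> has_vector_derivative X j (\<gamma> t)) (at t within {0..T})"
proof -
  have R: "\<exists>\<epsilon>>0. (\<gamma> has_vector_derivative X j (\<gamma> t)) (at t within {0..T} \<inter> {t..t + \<epsilon>})"
  proof (cases "t < T")
    case True
    obtain i where i: "i \<in> {1..k}" "departs (X i) (A i) \<gamma> t"
      by (rule local_solution_departs[OF sol, of t]) (use t True in auto)
    then have "i = j" using departs_interior j by blast
    then obtain \<epsilon> where "\<epsilon> > 0" "trajectory_on (X j) {t..t + \<epsilon>} \<gamma>"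
      using i(2) by (auto simp: departs_def)
    then have "(\<gamma> has_vector_derivative X j (\<gamma> t)) (at t within {t..t + \<epsilon>})"
      by (auto simp: trajectory_on_def)
    then show ?thesis using \<open>\<epsilon> > 0\<close> has_vector_derivative_within_subset[OF _ Int_lower2] by blast
  next
    case False
    \<comment> \<open>At the right end of the interval this half is a single point, within which
      every vector is a derivative.\<close>
    then have "{0..T} \<inter> {t..t + 1} = {t}" using t by auto
    then show ?thesis
      by (intro exI[of _ 1])
        (simp add: has_vector_derivative_def has_derivative_within_singleton_iff bounded_linear_scaleR_left)
  qed
  have L: "\<exists>\<epsilon>>0. (\<gamma> has_vector_derivative X j (\<gamma> t)) (at t within {0..T} \<inter> {t - \<epsilon>..t})"
  proof (cases "0 < t")
    case True
    obtain i where i: "i \<in> {1..k}" "arrives (X i) (A i) \<gamma> t"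
      by (rule local_solution_arrives[OF sol, of t]) (use t True in auto)
    then have "i = j" using arrives_interior j by blast
    then obtain \<epsilon> where "\<epsilon> > 0" "trajectory_on (X j) {t - \<epsilon>..t} \<gamma>"
      using i(2) by (auto simp: arrives_def)
    then have "(\<gamma> has_vector_derivative X j (\<gamma> t)) (at t within {t - \<epsilon>..t})"
      by (auto simp: trajectory_on_def)
    then show ?thesis using \<open>\<epsilon> > 0\<close> has_vector_derivative_within_subset[OF _ Int_lower2] by blast
  next
    case False
    then have "{0..T} \<inter> {t - 1..t} = {t}" using t by auto
    then show ?thesis
      by (intro exI[of _ 1])
        (simp add: has_vector_derivative_def has_derivative_within_singleton_iff bounded_linear_scaleR_left)
  qed
  obtain \<epsilon>1 \<epsilon>2 where \<epsilon>: "\<epsilon>1 > 0" "\<epsilon>2 > 0"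
    and d: "(\<gamma> has_vector_derivative X j (\<gamma> t)) (at t within ({0..T} \<inter> {t..t + \<epsilon>1} \<union> {0..T} \<inter> {t - \<epsilon>2..t}))"
    using R L has_vector_derivative_Un by blast
  have "at t within ({0..T} \<inter> {t..t + \<epsilon>1} \<union> {0..T} \<inter> {t - \<epsilon>2..t}) = at t within {0..T}"
    by (rule at_within_nhd[of t "{t - \<epsilon>2<..<t + \<epsilon>1}"]) (use \<epsilon> in auto)
  then show ?thesis using d by simp
qed

text \<open>\<open>solution_on\<close> asks for two distinct adjacent components even at time 0 or
  \<open>T\<close>, where one side is void. The chart at the crossing point supplies the pair, and
  the germs present are forced to match it.\<close>

lemma local_solution_imp_solution_on:
  assumes sol: "local_solution T \<gamma>"
  shows "solution_on N h k A X T (\<gamma> 0) \<gamma>"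
  unfolding solution_on_def
proof (intro conjI ballI impI refl)
  fix t assume t: "t \<in> {0..T}"
  show "(\<gamma> has_vector_derivative X j (\<gamma> t)) (at t within {0..T})" if "j \<in> {1..k}" "\<gamma> t \<in> A j" for j
    using local_solution_has_vector_derivative[OF sol t that] .
  assume "\<gamma> t \<in> \<Sigma>"
  then show cr: "crossing (\<gamma> t)" using sol t by (simp add: local_solution_def)
  then obtain \<rho> H D a b where c: "crossing_chart (\<gamma> t) \<rho> H D a b" using crossing_chart_exists by metis
  then have ab: "a \<in> {1..k}" "b \<in> {1..k}" "a \<noteq> b" "\<gamma> t \<in> closure (A a) \<inter> closure (A b)"
    unfolding crossing_chart_def by auto
  obtain \<epsilon>1 where \<epsilon>1: "\<epsilon>1 > 0" "trajectory_on (X a) ({0..T} \<inter> {t - \<epsilon>1..t}) \<gamma>"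
    "\<gamma> ` ({0..T} \<inter> {t - \<epsilon>1<..<t}) \<subseteq> A a"
  proof (cases "0 < t")
    case True
    obtain i where i: "i \<in> {1..k}" "arrives (X i) (A i) \<gamma> t"
      by (rule local_solution_arrives[OF sol, of t]) (use t True in auto)
    then have "i = a" using arrives_crossing[OF c] by blast
    then obtain \<epsilon> where \<epsilon>: "\<epsilon> > 0" "trajectory_on (X a) {t - \<epsilon>..t} \<gamma>" "\<gamma> ` {t - \<epsilon><..<t} \<subseteq> A a"
      using i(2) by (auto simp: arrives_def)
    show ?thesis by (rule that[OF \<epsilon>(1) trajectory_on_subset[OF \<epsilon>(2)]]) (use \<epsilon>(3) in auto)
  next
    case False
    then have "{0..T} \<inter> {t - 1..t} = {t}" "{0..T} \<inter> {t - 1<..<t} = {}" using t by auto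
    then show ?thesis
      by (intro that[of 1]) (simp_all add: trajectory_on_def has_vector_derivative_def
          has_derivative_within_singleton_iff bounded_linear_scaleR_left)
  qed
  obtain \<epsilon>2 where \<epsilon>2: "\<epsilon>2 > 0" "trajectory_on (X b) ({0..T} \<inter> {t..t + \<epsilon>2}) \<gamma>"
    "\<gamma> ` ({0..T} \<inter> {t<..<t + \<epsilon>2}) \<subseteq> A b"
  proof (cases "t < T")
    case True
    obtain i where i: "i \<in> {1..k}" "departs (X i) (A i) \<gamma> t"
      by (rule local_solution_departs[OF sol, of t]) (use t True in auto)
    then have "i = b" using departs_crossing[OF c] by blast
    then obtain \<epsilon> where \<epsilon>: "\<epsilon> > 0" "trajectory_on (X b) {t..t + \<epsilon>} \<gamma>" "\<gamma> ` {t<..<t + \<epsilon>} \<subseteq> A b"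
      using i(2) by (auto simp: departs_def)
    show ?thesis by (rule that[OF \<epsilon>(1) trajectory_on_subset[OF \<epsilon>(2)]]) (use \<epsilon>(3) in auto)
  next
    case False
    then have "{0..T} \<inter> {t..t + 1} = {t}" "{0..T} \<inter> {t<..<t + 1} = {}" using t by auto
    then show ?thesis
      by (intro that[of 1]) (simp_all add: trajectory_on_def has_vector_derivative_def
          has_derivative_within_singleton_iff bounded_linear_scaleR_left)
  qed
  define \<epsilon> where "\<epsilon> = min \<epsilon>1 \<epsilon>2"
  show "\<exists>a\<in>{1..k}. \<exists>b\<in>{1..k}. \<exists>\<epsilon>>0.
      a \<noteq> b \<and> \<gamma> t \<in> closure (A a) \<inter> closure (A b) \<and>
      trajectory_on (X a) ({0..T} \<inter> {t - \<epsilon>..t}) \<gamma> \<and>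
      \<gamma> ` ({0..T} \<inter> {t - \<epsilon><..<t}) \<subseteq> A a \<and>
      trajectory_on (X b) ({0..T} \<inter> {t..t + \<epsilon>}) \<gamma> \<and>
      \<gamma> ` ({0..T} \<inter> {t<..<t + \<epsilon>}) \<subseteq> A b"
  proof (intro bexI exI conjI)
    show "\<epsilon> > 0" using \<epsilon>1(1) \<epsilon>2(1) by (simp add: \<epsilon>_def)
    show "trajectory_on (X a) ({0..T} \<inter> {t - \<epsilon>..t}) \<gamma>"
      by (rule trajectory_on_subset[OF \<epsilon>1(2)]) (auto simp: \<epsilon>_def)
    show "trajectory_on (X b) ({0..T} \<inter> {t..t + \<epsilon>}) \<gamma>"
      by (rule trajectory_on_subset[OF \<epsilon>2(2)]) (auto simp: \<epsilon>_def)
    show "\<gamma> ` ({0..T} \<inter> {t - \<epsilon><..<t}) \<subseteq> A a"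
      by (rule order_trans[OF image_mono \<epsilon>1(3)]) (auto simp: \<epsilon>_def)
    show "\<gamma> ` ({0..T} \<inter> {t<..<t + \<epsilon>}) \<subseteq> A b"
      by (rule order_trans[OF image_mono \<epsilon>2(3)]) (auto simp: \<epsilon>_def)
  qed (use ab in auto)
qed

lemma solution_on_continuous:
  assumes sol: "solution_on N h k A X T x \<gamma>"
  shows "continuous_on {0..T} \<gamma>"
  unfolding continuous_on_def
proof
  fix t assume t: "t \<in> {0..T}"
  show "(\<gamma> \<longlongrightarrow> \<gamma> t) (at t within {0..T})"
  proof (cases "\<gamma> t \<in> \<Sigma>")
    case False
    then obtain j where j: "j \<in> {1..k}" "\<gamma> t \<in> A j" using A_cover by blast
    then have "(\<gamma> has_vector_derivative X j (\<gamma> t)) (at t within {0..T})"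
      using sol t unfolding solution_on_def by blast
    then have "continuous (at t within {0..T}) \<gamma>" by (rule has_vector_derivative_continuous)
    then show ?thesis by (simp add: continuous_within)
  next
    case True
    then obtain a b \<epsilon> where \<epsilon>: "\<epsilon> > 0" "trajectory_on (X a) ({0..T} \<inter> {t - \<epsilon>..t}) \<gamma>"
      "trajectory_on (X b) ({0..T} \<inter> {t..t + \<epsilon>}) \<gamma>"
      using sol t unfolding solution_on_def by blast
    have "(\<gamma> \<longlongrightarrow> \<gamma> t) (at t within ({0..T} \<inter> {t - \<epsilon>..t} \<union> {0..T} \<inter> {t..t + \<epsilon>}))"
      unfolding at_within_union
      using trajectory_on_continuous[OF \<epsilon>(2)] trajectory_on_continuous[OF \<epsilon>(3)] t \<epsilon>(1)
      by (intro filterlim_sup) (auto simp: continuous_on_def)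
    moreover have "at t within ({0..T} \<inter> {t - \<epsilon>..t} \<union> {0..T} \<inter> {t..t + \<epsilon>}) = at t within {0..T}"
      by (rule at_within_nhd[of t "{t - \<epsilon><..<t + \<epsilon>}"]) (use \<epsilon> in auto)
    ultimately show ?thesis by simp
  qed
qed

text \<open>\<open>solution_on\<close> gives the equation only at times when the curve is in
  \<open>A j\<close>. Continuity keeps it in this open set for a while, which turns the pointwise
  statements into a trajectory.\<close>

lemma solution_on_near_interior:
  assumes sol: "solution_on N h k A X T x \<gamma>" and t: "t \<in> {0..T}" and j: "j \<in> {1..k}" "\<gamma> t \<in> A j"
  obtains d where "d > 0" "\<gamma> ` ({0..T} \<inter> {t - d..t + d}) \<subseteq> A j"
    "trajectory_on (X j) ({0..T} \<inter> {t - d..t + d}) \<gamma>"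
proof -
  have "\<forall>\<^sub>F s in at t within {0..T}. \<gamma> s \<in> A j"
    using solution_on_continuous[OF sol] t A_open[OF j(1)] j(2)
    unfolding continuous_on_def by (metis topological_tendstoD)
  then obtain d where d: "d > 0" "\<And>s. s \<in> {0..T} \<Longrightarrow> s \<noteq> t \<Longrightarrow> dist s t < d \<Longrightarrow> \<gamma> s \<in> A j"
    unfolding eventually_at by blast
  have in_A: "\<gamma> s \<in> A j" if "s \<in> {0..T} \<inter> {t - d / 2..t + d / 2}" for s
    using d(2)[of s] d(1) j(2) that by (cases "s = t") (auto simp: dist_real_def)
  moreover have "trajectory_on (X j) ({0..T} \<inter> {t - d / 2..t + d / 2}) \<gamma>"
    unfolding trajectory_on_def
  proof
    fix s assume s: "s \<in> {0..T} \<inter> {t - d / 2..t + d / 2}"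
    then have "(\<gamma> has_vector_derivative X j (\<gamma> s)) (at s within {0..T})"
      using sol in_A[OF s] j(1) unfolding solution_on_def by blast
    then show "(\<gamma> has_vector_derivative X j (\<gamma> s)) (at s within {0..T} \<inter> {t - d / 2..t + d / 2})"
      by (rule has_vector_derivative_within_subset) auto
  qed
  ultimately show ?thesis by (intro that[of "d / 2"] image_subsetI) (use d(1) in simp_all)
qed

lemma solution_on_imp_local_solution:
  assumes sol: "solution_on N h k A X T x \<gamma>"
  shows "local_solution T \<gamma>"
  unfolding local_solution_def
proof (intro conjI ballI)
  show "\<gamma> t \<in> \<Sigma> \<longrightarrow> crossing (\<gamma> t)" if "t \<in> {0..T}" for t
    using sol that by (simp add: solution_on_def)
  \<comment> \<open>One statement for times on and off the switching set; off it, \<open>a\<close>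
    and \<open>b\<close> are both the component containing \<open>\<gamma> t\<close>.\<close>
  have both: "\<exists>a\<in>{1..k}. \<exists>b\<in>{1..k}. \<exists>\<epsilon>>0.
      trajectory_on (X a) ({0..T} \<inter> {t - \<epsilon>..t}) \<gamma> \<and> \<gamma> ` ({0..T} \<inter> {t - \<epsilon><..<t}) \<subseteq> A a \<and>
      trajectory_on (X b) ({0..T} \<inter> {t..t + \<epsilon>}) \<gamma> \<and> \<gamma> ` ({0..T} \<inter> {t<..<t + \<epsilon>}) \<subseteq> A b"
    if t: "t \<in> {0..T}" for t
  proof (cases "\<gamma> t \<in> \<Sigma>")
    case True
    then show ?thesis using sol t unfolding solution_on_def by blast
  next
    case False
    then obtain j where j: "j \<in> {1..k}" "\<gamma> t \<in> A j" using A_cover by blast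
    obtain d where d: "d > 0" "\<gamma> ` ({0..T} \<inter> {t - d..t + d}) \<subseteq> A j"
      "trajectory_on (X j) ({0..T} \<inter> {t - d..t + d}) \<gamma>"
      using solution_on_near_interior[OF sol t j] .
    have "trajectory_on (X j) ({0..T} \<inter> {t - d..t}) \<gamma>" "trajectory_on (X j) ({0..T} \<inter> {t..t + d}) \<gamma>"
      by (rule trajectory_on_subset[OF d(3)]; use d(1) in auto)+
    moreover have "\<gamma> ` ({0..T} \<inter> {t - d<..<t}) \<subseteq> A j" "\<gamma> ` ({0..T} \<inter> {t<..<t + d}) \<subseteq> A j"
      by (rule order_trans[OF image_mono d(2)]; use d(1) in auto)+
    ultimately show ?thesis using j(1) d(1) by blast
  qed
  show "\<exists>j\<in>{1..k}. departs (X j) (A j) \<gamma> t" if t: "t \<in> {0..<T}" for t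
  proof -
    have "t \<in> {0..T}" using t by auto
    from both[OF this] obtain j \<epsilon> where j: "j \<in> {1..k}" "\<epsilon> > 0"
      "trajectory_on (X j) ({0..T} \<inter> {t..t + \<epsilon>}) \<gamma>" "\<gamma> ` ({0..T} \<inter> {t<..<t + \<epsilon>}) \<subseteq> A j"
      by blast
    \<comment> \<open>Cut down so that \<open>{t..t + e}\<close> lies in \<open>{0..T}\<close> and
      the intersection disappears.\<close>
    define e where "e = min \<epsilon> (T - t)"
    have "trajectory_on (X j) {t..t + e} \<gamma>"
      by (rule trajectory_on_subset[OF j(3)]) (use t in \<open>auto simp: e_def\<close>)
    moreover have "\<gamma> ` {t<..<t + e} \<subseteq> A j"
      by (rule order_trans[OF image_mono j(4)]) (use t in \<open>auto simp: e_def\<close>)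
    moreover have "e > 0" using j(2) t by (simp add: e_def)
    ultimately show ?thesis using j(1) unfolding departs_def by blast
  qed
  show "\<exists>j\<in>{1..k}. arrives (X j) (A j) \<gamma> t" if t: "t \<in> {0<..T}" for t
  proof -
    have "t \<in> {0..T}" using t by auto
    from both[OF this] obtain j \<epsilon> where j: "j \<in> {1..k}" "\<epsilon> > 0"
      "trajectory_on (X j) ({0..T} \<inter> {t - \<epsilon>..t}) \<gamma>" "\<gamma> ` ({0..T} \<inter> {t - \<epsilon><..<t}) \<subseteq> A j"
      by blast
    define e where "e = min \<epsilon> t"
    have "trajectory_on (X j) {t - e..t} \<gamma>"
      by (rule trajectory_on_subset[OF j(3)]) (use t in \<open>auto simp: e_def\<close>)
    moreover have "\<gamma> ` {t - e<..<t} \<subseteq> A j"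
      by (rule order_trans[OF image_mono j(4)]) (use t in \<open>auto simp: e_def\<close>)
    moreover have "e > 0" using j(2) t by (simp add: e_def)
    ultimately show ?thesis using j(1) unfolding arrives_def by blast
  qed
qed

lemma solution_on_iff: "solution_on N h k A X T x \<gamma> \<longleftrightarrow> \<gamma> 0 = x \<and> local_solution T \<gamma>"
  using solution_on_imp_local_solution local_solution_imp_solution_on
  by (metis solution_on_def)

text \<open>At the infimum \<open>m\<close> of the times of disagreement the curves still agree, by
  the common start or by continuity from the left. From there both depart with the same field, and
  Gronwall with initial distance 0 carries the agreement past \<open>m\<close>.\<close>

lemma local_solution_unique:
  assumes 1: "local_solution T \<gamma>" and 2: "local_solution T \<gamma>'" and eq0: "\<gamma> 0 = \<gamma>' 0"
    and t: "t \<in> {0..T}"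
  shows "\<gamma> t = \<gamma>' t"
proof (rule ccontr)
  assume ne: "\<gamma> t \<noteq> \<gamma>' t"
  define E where "E = {s\<in>{0..T}. \<gamma> s \<noteq> \<gamma>' s}"
  define m where "m = Inf E"
  have tE: "t \<in> E" using t ne by (simp add: E_def)
  have bdd: "bdd_below E" by (auto simp: E_def intro: bdd_belowI[of _ 0])
  have m0: "0 \<le> m" unfolding m_def using tE by (intro cInf_greatest) (auto simp: E_def)
  have mt: "m \<le> t" unfolding m_def by (rule cInf_lower[OF tE bdd])
  have before: "\<gamma> s = \<gamma>' s" if "0 \<le> s" "s < m" for s
  proof (rule ccontr)
    assume "\<gamma> s \<noteq> \<gamma>' s"
    then have "s \<in> E" using that mt t by (simp add: E_def)
    then have "m \<le> s" unfolding m_def by (rule cInf_lower[OF _ bdd])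
    then show False using that by simp
  qed
  have eqm: "\<gamma> m = \<gamma>' m"
  proof (cases "m = 0")
    case False
    then have m: "m \<in> {0<..T}" using m0 mt t by auto
    have l: "(\<gamma> \<longlongrightarrow> \<gamma> m) (at_left m)" "(\<gamma>' \<longlongrightarrow> \<gamma>' m) (at_left m)"
      using 1 2 m arrives_tendsto unfolding local_solution_def by blast+
    have "\<forall>\<^sub>F s in at_left m. \<gamma> s = \<gamma>' s"
      unfolding eventually_at_left_field using m before by (intro exI[of _ 0]) auto
    then have "(\<gamma>' \<longlongrightarrow> \<gamma> m) (at_left m)" by (rule Lim_transform_eventually[OF l(1)])
    then show ?thesis using tendsto_unique[OF _ _ l(2)] by simp
  qed (use eq0 in simp)
  have "m < t" using mt eqm ne by (cases "m = t") auto
  then have m: "m \<in> {0..<T}" "m \<in> {0..T}" using m0 t by auto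
  obtain i where i: "i \<in> {1..k}" "departs (X i) (A i) \<gamma> m" using 1 m unfolding local_solution_def by blast
  obtain j where j: "j \<in> {1..k}" "departs (X j) (A j) \<gamma>' m" using 2 m unfolding local_solution_def by blast
  have "\<gamma> m \<in> \<Sigma> \<longrightarrow> crossing (\<gamma> m)" using 1 m(2) by (simp add: local_solution_def)
  then have ij: "i = j" using departs_unique eqm i j by blast
  obtain \<rho> L where \<rho>: "\<rho> > 0" and L: "L-lipschitz_on (cball (\<gamma> m) \<rho>) (X i)"
    using X_local_lipschitz[OF i(1) departs_closure[OF i(2)]] .
  have "\<forall>\<^sub>F s in at_right m. \<gamma> s \<in> ball (\<gamma> m) \<rho> \<and> \<gamma>' s \<in> ball (\<gamma> m) \<rho>"
    using topological_tendstoD[OF departs_tendsto[OF i(2)], of "ball (\<gamma> m) \<rho>"]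
      topological_tendstoD[OF departs_tendsto[OF j(2)], of "ball (\<gamma> m) \<rho>"] \<rho> eqm
    by (intro eventually_conj) auto
  then obtain m' where m': "m < m'"
    "\<And>s. m < s \<Longrightarrow> s < m' \<Longrightarrow> \<gamma> s \<in> ball (\<gamma> m) \<rho> \<and> \<gamma>' s \<in> ball (\<gamma> m) \<rho>"
    unfolding eventually_at_right_field by blast
  have inb: "\<gamma> s \<in> cball (\<gamma> m) \<rho>" "\<gamma>' s \<in> cball (\<gamma> m) \<rho>" if "m \<le> s" "s < m'" for s
    using m'(2)[of s] that eqm \<rho> by (cases "s = m"; force)+
  define e where "e = (m' - m) / 2"
  have e: "e > 0" "m + e < m'" using m'(1) by (auto simp: e_def field_simps)
  obtain \<epsilon>1 where \<epsilon>1: "0 < \<epsilon>1" "\<epsilon>1 \<le> e" "trajectory_on (X i) {m..m + \<epsilon>1} \<gamma>"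
    using departsE[OF i(2) e(1)] by metis
  obtain \<epsilon>2 where \<epsilon>2: "0 < \<epsilon>2" "\<epsilon>2 \<le> \<epsilon>1" "trajectory_on (X i) {m..m + \<epsilon>2} \<gamma>'"
    using departsE[OF j(2) \<epsilon>1(1)] ij by metis
  have after: "\<gamma> s = \<gamma>' s" if s: "s \<in> {m..m + \<epsilon>2}" for s
  proof -
    have "norm (\<gamma> s - \<gamma>' s) \<le> exp (L * (s - m)) * norm (\<gamma> m - \<gamma>' m)"
    proof (rule trajectory_gronwall[OF _ \<epsilon>2(3) L _ _ s])
      show "trajectory_on (X i) {m..m + \<epsilon>2} \<gamma>" by (rule trajectory_on_subset[OF \<epsilon>1(3)]) (use \<epsilon>2 in auto)
      show "\<gamma> ` {m..m + \<epsilon>2} \<subseteq> cball (\<gamma> m) \<rho>"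
        by (rule image_subsetI, rule inb) (use \<epsilon>1 \<epsilon>2 e in auto)
      show "\<gamma>' ` {m..m + \<epsilon>2} \<subseteq> cball (\<gamma> m) \<rho>"
        by (rule image_subsetI, rule inb) (use \<epsilon>1 \<epsilon>2 e in auto)
    qed
    then show ?thesis using eqm by simp
  qed
  have "m + \<epsilon>2 \<le> Inf E"
  proof (rule cInf_greatest)
    show "E \<noteq> {}" using tE by blast
    fix s assume s: "s \<in> E"
    show "m + \<epsilon>2 \<le> s"
    proof (rule ccontr)
      assume "\<not> m + \<epsilon>2 \<le> s"
      then have "s < m \<or> s \<in> {m..m + \<epsilon>2}" by auto
      then have "\<gamma> s = \<gamma>' s" using before after s by (auto simp: E_def)
      then show False using s by (simp add: E_def)
    qed
  qed
  then show False using \<epsilon>2(1) by (simp add: m_def)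
qed

text \<open>Uniqueness makes the definite description in \<open>flow\<close> denote the endpoint of
  whatever solution is at hand.\<close>

lemma flow_eq:
  assumes "local_solution t \<gamma>" "0 \<le> t"
  shows "flow N h k A X t (\<gamma> 0) = \<gamma> t"
  unfolding flow_def
proof (rule the_equality)
  show "\<exists>\<gamma>'. solution_on N h k A X t (\<gamma> 0) \<gamma>' \<and> \<gamma>' t = \<gamma> t"
    using assms solution_on_iff by blast
  show "y = \<gamma> t" if "\<exists>\<gamma>'. solution_on N h k A X t (\<gamma> 0) \<gamma>' \<and> \<gamma>' t = y" for y
    using that local_solution_unique[OF _ assms(1)] assms(2) by (auto simp: solution_on_iff)
qed

end

section \<open>Continuity of the flow\<close>

context piecewise_field
begin

text \<open>Only the two ends may touch the switching set, which is the shape of the pieces before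
  and after a crossing.\<close>

lemma trajectory_local_solution:
  assumes j: "j \<in> {1..k}" and u: "trajectory_on (X j) {0..d} u"
    and inside: "\<And>t. 0 < t \<Longrightarrow> t < d \<Longrightarrow> u t \<in> A j"
    and ends: "u 0 \<in> \<Sigma> \<Longrightarrow> crossing (u 0)" "u d \<in> \<Sigma> \<Longrightarrow> crossing (u d)"
  shows "local_solution d u"
  unfolding local_solution_def
proof (intro conjI ballI)
  show "u t \<in> \<Sigma> \<longrightarrow> crossing (u t)" if t: "t \<in> {0..d}" for t
  proof -
    consider "t = 0" | "t = d" | "0 < t" "t < d" using t by fastforce
    then show ?thesis
    proof cases
      case 3
      then show ?thesis using inside A_subset[OF j] by blast
    qed (use ends in auto)
  qed
  show "\<exists>j\<in>{1..k}. departs (X j) (A j) u t" if t: "t \<in> {0..<d}" for t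
  proof -
    have "trajectory_on (X j) {t..t + (d - t)} u" by (rule trajectory_on_subset[OF u]) (use t in auto)
    moreover have "u ` {t<..<t + (d - t)} \<subseteq> A j" using inside t by auto
    moreover have "d - t > 0" using t by simp
    ultimately show ?thesis using j unfolding departs_def by blast
  qed
  show "\<exists>j\<in>{1..k}. arrives (X j) (A j) u t" if t: "t \<in> {0<..d}" for t
  proof -
    have "trajectory_on (X j) {t - t..t} u" by (rule trajectory_on_subset[OF u]) (use t in auto)
    moreover have "u ` {t - t<..<t} \<subseteq> A j" using inside t by auto
    moreover have "t > 0" using t by simp
    ultimately show ?thesis using j unfolding arrives_def by blast
  qed
qed

text \<open>A time-\<open>t\<close> map certified by witness solutions rather than through
  \<open>flow\<close>, so that maps for successive times compose by concatenating witnesses.\<close>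

definition continuous_flow :: "(real ^ 'n) set \<Rightarrow> real \<Rightarrow> (real ^ 'n \<Rightarrow> real ^ 'n) \<Rightarrow> bool" where
  "continuous_flow W t \<Psi> \<longleftrightarrow>
     continuous_on W \<Psi> \<and> (\<forall>r\<in>W. \<exists>\<gamma>. \<gamma> 0 = r \<and> local_solution t \<gamma> \<and> \<gamma> t = \<Psi> r)"

text \<open>Trajectories from the half ball stay in a ball inside \<open>A j\<close>, where they are
  solutions. One \<open>W\<close> serves all times up to \<open>\<delta>\<close>, as the lengths of
  the pieces into which an orbit is later cut are not known in advance.\<close>

lemma interior_local_flow:
  assumes j: "j \<in> {1..k}" and p: "p \<in> A j"
  shows "\<exists>W \<delta>. open W \<and> p \<in> W \<and> \<delta> > 0 \<and> (\<forall>t\<in>{0..\<delta>}. \<exists>\<Psi>. continuous_flow W t \<Psi>)"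
proof -
  obtain \<rho>1 L where \<rho>1: "\<rho>1 > 0" and L: "L-lipschitz_on (cball p \<rho>1) (X j)"
    using X_local_lipschitz[OF j] p closure_subset by blast
  obtain \<rho>2 where \<rho>2: "\<rho>2 > 0" "ball p \<rho>2 \<subseteq> A j"
    using A_open[OF j] p open_contains_ball by blast
  define \<rho> where "\<rho> = min \<rho>1 \<rho>2"
  have \<rho>: "\<rho> > 0" "ball p \<rho> \<subseteq> A j" using \<rho>1 \<rho>2 by (auto simp: \<rho>_def)
  have "L-lipschitz_on (cball p \<rho>) (X j)"
    by (rule lipschitz_on_subset[OF L]) (auto simp: \<rho>_def)
  then obtain d \<phi> where d: "d > 0"
    and \<phi>0: "\<And>r. r \<in> ball p (\<rho>/2) \<Longrightarrow> \<phi> r 0 = r"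
    and \<phi>: "\<And>r. r \<in> ball p (\<rho>/2) \<Longrightarrow> trajectory_on (X j) {0..d} (\<phi> r)"
    and \<phi>b: "\<And>r. r \<in> ball p (\<rho>/2) \<Longrightarrow> \<phi> r ` {0..d} \<subseteq> ball p \<rho>"
    and cont: "continuous_on (ball p (\<rho>/2) \<times> {0..d}) (\<lambda>(r, t). \<phi> r t)"
    using local_flow[OF \<rho>(1)] by metis
  have "continuous_flow (ball p (\<rho>/2)) t (\<lambda>r. \<phi> r t)" if t: "t \<in> {0..d}" for t
    unfolding continuous_flow_def
  proof (intro conjI ballI)
    have "continuous_on (ball p (\<rho>/2)) (\<lambda>r. case (r, t) of (r, t) \<Rightarrow> \<phi> r t)"
      by (rule continuous_on_compose2[OF cont]) (use t in \<open>auto intro!: continuous_intros\<close>)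
    then show "continuous_on (ball p (\<rho>/2)) (\<lambda>r. \<phi> r t)" by simp
    fix r assume r: "r \<in> ball p (\<rho>/2)"
    have inA: "\<phi> r s \<in> A j" if "s \<in> {0..d}" for s using \<phi>b[OF r] \<rho>(2) that by blast
    have off: "\<phi> r s \<notin> \<Sigma>" if "s \<in> {0..d}" for s using inA[OF that] A_subset[OF j] by blast
    have "local_solution t (\<phi> r)"
    proof (rule trajectory_local_solution[OF j])
      show "trajectory_on (X j) {0..t} (\<phi> r)" by (rule trajectory_on_subset[OF \<phi>[OF r]]) (use t in auto)
    qed (use off[of 0] off[of t] inA t in auto)
    then show "\<exists>\<gamma>. \<gamma> 0 = r \<and> local_solution t \<gamma> \<and> \<gamma> t = \<phi> r t" using \<phi>0[OF r] by blast
  qed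
  moreover have "open (ball p (\<rho>/2))" "p \<in> ball p (\<rho>/2)" using \<rho>(1) by auto
  ultimately show ?thesis using d by blast
qed

text \<open>Near a crossing point, follow the incoming field up to the hitting time \<open>\<tau>\<close> of the switching
  surface and the outgoing field afterwards.  Truncating \<open>\<tau>\<close> to the time interval under
  consideration covers the starting points on either side of the surface by a single formula.\<close>

lemma crossing_local_flow:
  assumes "crossing p"
  shows "\<exists>W \<delta>. open W \<and> p \<in> W \<and> \<delta> > 0 \<and> (\<forall>t\<in>{0..\<delta>}. \<exists>\<Psi>. continuous_flow W t \<Psi>)"
proof -
  obtain \<rho> H D a b where c: "crossing_chart p \<rho> H D a b"
    using crossing_chart_exists[OF assms] .
  have \<rho>: "\<rho> > 0" and a: "a \<in> {1..k}" and b: "b \<in> {1..k}"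
    and der: "\<And>q. q \<in> ball p \<rho> \<Longrightarrow> (H has_derivative D q) (at q)"
    and Da: "\<And>q. q \<in> ball p \<rho> \<Longrightarrow> D q (X a q) > 0" and Db: "\<And>q. q \<in> ball p \<rho> \<Longrightarrow> D q (X b q) > 0"
    and pos: "\<And>q. q \<in> ball p \<rho> \<Longrightarrow> H q > 0 \<Longrightarrow> q \<in> A b"
    and neg: "\<And>q. q \<in> ball p \<rho> \<Longrightarrow> H q < 0 \<Longrightarrow> q \<in> A a"
    and zero: "\<And>q. q \<in> ball p \<rho> \<Longrightarrow> H q = 0 \<Longrightarrow> crossing q"
    using c unfolding crossing_chart_def by blast+
  have cl: "p \<in> closure (A a)" "p \<in> closure (A b)"
    using c unfolding crossing_chart_def by auto
  have cross: "crossing q" if "q \<in> ball p \<rho>" "q \<in> \<Sigma>" for q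
  proof (rule zero[OF that(1)], rule ccontr)
    assume "H q \<noteq> 0"
    then have "q \<in> A b \<or> q \<in> A a" using pos[OF that(1)] neg[OF that(1)] by linarith
    then show False using A_subset[OF a] A_subset[OF b] that(2) by blast
  qed
  obtain \<rho>a La where \<rho>a: "\<rho>a > 0" and La: "La-lipschitz_on (cball p \<rho>a) (X a)"
    using X_local_lipschitz[OF a cl(1)] .
  obtain \<rho>b Lb where \<rho>b: "\<rho>b > 0" and Lb: "Lb-lipschitz_on (cball p \<rho>b) (X b)"
    using X_local_lipschitz[OF b cl(2)] .
  \<comment> \<open>Nested balls for two successive flows: from radius \<open>\<sigma>/2/2\<close>
    the field \<open>X a\<close> stays within \<open>\<sigma>/2\<close>, and from there
    \<open>X b\<close> stays within \<open>\<sigma>\<close>, where the chart and both Lipschitz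
    bounds hold.\<close>
  define \<sigma> where "\<sigma> = min \<rho> (min \<rho>a \<rho>b)"
  have \<sigma>: "\<sigma> > 0" "\<sigma> \<le> \<rho>" "\<sigma> \<le> \<rho>a" "\<sigma> \<le> \<rho>b" using \<rho> \<rho>a \<rho>b by (auto simp: \<sigma>_def)
  have "Lb-lipschitz_on (cball p \<sigma>) (X b)" by (rule lipschitz_on_subset[OF Lb]) (use \<sigma> in auto)
  then obtain db \<phi>b where db: "db > 0"
    and \<phi>b0: "\<And>r. r \<in> ball p (\<sigma>/2) \<Longrightarrow> \<phi>b r 0 = r"
    and \<phi>b: "\<And>r. r \<in> ball p (\<sigma>/2) \<Longrightarrow> trajectory_on (X b) {0..db} (\<phi>b r)"
    and \<phi>bb: "\<And>r. r \<in> ball p (\<sigma>/2) \<Longrightarrow> \<phi>b r ` {0..db} \<subseteq> ball p \<sigma>"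
    and contb: "continuous_on (ball p (\<sigma>/2) \<times> {0..db}) (\<lambda>(r, t). \<phi>b r t)"
    using local_flow[OF \<sigma>(1)] by metis
  have "La-lipschitz_on (cball p (\<sigma>/2)) (X a)" by (rule lipschitz_on_subset[OF La]) (use \<sigma> in auto)
  moreover have \<sigma>2: "\<sigma>/2 > 0" using \<sigma> by simp
  ultimately obtain da \<phi>a where da: "da > 0"
    and \<phi>a0: "\<And>r. r \<in> ball p (\<sigma>/2/2) \<Longrightarrow> \<phi>a r 0 = r"
    and \<phi>a: "\<And>r. r \<in> ball p (\<sigma>/2/2) \<Longrightarrow> trajectory_on (X a) {0..da} (\<phi>a r)"
    and \<phi>ab: "\<And>r. r \<in> ball p (\<sigma>/2/2) \<Longrightarrow> \<phi>a r ` {0..da} \<subseteq> ball p (\<sigma>/2)"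
    and conta: "continuous_on (ball p (\<sigma>/2/2) \<times> {0..da}) (\<lambda>(r, t). \<phi>a r t)"
    using local_flow[of "\<sigma>/2" La p "X a"] by metis
  define d where "d = min da db"
  have d: "d > 0" "d \<le> da" "d \<le> db" using da db by (auto simp: d_def)
  define W where "W = ball p (\<sigma>/2/2)"
  define W' where "W' = ball p (\<sigma>/2)"
  have WW': "W \<subseteq> W'" using \<sigma>(1) by (auto simp: W_def W'_def)
  have W'\<rho>: "W' \<subseteq> ball p \<rho>" using \<sigma> by (auto simp: W'_def)
  have a_in: "\<phi>a r s \<in> W'" if "r \<in> W" "s \<in> {0..d}" for r s
    using \<phi>ab[of r] that d(2) by (fastforce simp: W_def W'_def image_subset_iff)
  have b_in: "\<phi>b r s \<in> ball p \<rho>" if "r \<in> W'" "s \<in> {0..d}" for r s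
  proof -
    have "s \<in> {0..db}" using that d(3) by auto
    then have "\<phi>b r s \<in> ball p \<sigma>" using \<phi>bb[of r] that(1) unfolding W'_def by blast
    then show ?thesis using \<sigma>(2) by auto
  qed
  have a_traj: "trajectory_on (X a) {0..d} (\<phi>a r)" if "r \<in> W" for r
    by (rule trajectory_on_subset[OF \<phi>a]) (use that d in \<open>auto simp: W_def\<close>)
  have b_traj: "trajectory_on (X b) {0..d} (\<phi>b r)" if "r \<in> W'" for r
    by (rule trajectory_on_subset[OF \<phi>b]) (use that d in \<open>auto simp: W'_def\<close>)
  have a_incr: "H (\<phi>a r s) < H (\<phi>a r t)" if "r \<in> W" "0 \<le> s" "s < t" "t \<le> d" for r s t
  proof (rule increasing_along_trajectory[OF a_traj[OF that(1)], where D = D])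
    fix v assume "v \<in> {0..d}"
    then have "\<phi>a r v \<in> ball p \<rho>" using a_in that(1) W'\<rho> by blast
    then show "(H has_derivative D (\<phi>a r v)) (at (\<phi>a r v))" "0 < D (\<phi>a r v) (X a (\<phi>a r v))"
      using der Da by blast+
  qed (use that in auto)
  have b_incr: "H (\<phi>b r s) < H (\<phi>b r t)" if "r \<in> W'" "0 \<le> s" "s < t" "t \<le> d" for r s t
  proof (rule increasing_along_trajectory[OF b_traj[OF that(1)], where D = D])
    fix v assume "v \<in> {0..d}"
    then have "\<phi>b r v \<in> ball p \<rho>" using b_in that(1) by blast
    then show "(H has_derivative D (\<phi>b r v)) (at (\<phi>b r v))" "0 < D (\<phi>b r v) (X b (\<phi>b r v))"
      using der Db by blast+
  qed (use that in auto)
  have contH: "continuous_on (ball p \<rho>) H"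
    using der has_derivative_continuous by (metis continuous_at_imp_continuous_on)
  have contHa: "continuous_on (W \<times> {0..d}) (\<lambda>(r, s). H (\<phi>a r s))"
  proof -
    have "continuous_on (W \<times> {0..d}) (\<lambda>x. H (case x of (r, s) \<Rightarrow> \<phi>a r s))"
      by (rule continuous_on_compose2[OF contH continuous_on_subset[OF conta]])
        (use d a_in W'\<rho> in \<open>auto simp: W_def simp del: mem_ball\<close>)
    then show ?thesis by (simp add: case_prod_unfold)
  qed
  \<comment> \<open>The truncated hitting time, described by the sign pattern of \<open>H\<close>:
    it is 0 when the start has \<open>H \<ge> 0\<close>, \<open>d\<close> when \<open>H\<close> has
    not become positive by time \<open>d\<close>, and the zero given by the intermediate value
    theorem otherwise.\<close>
  have "\<exists>\<tau>\<in>{0..d}. (\<forall>s\<in>{0..d}. s < \<tau> \<longrightarrow> H (\<phi>a r s) < 0) \<and>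
      (\<forall>s\<in>{0..d}. \<tau> < s \<longrightarrow> H (\<phi>a r s) > 0) \<and>
      (H (\<phi>a r 0) < 0 \<longrightarrow> H (\<phi>a r d) > 0 \<longrightarrow> H (\<phi>a r \<tau>) = 0)" if r: "r \<in> W" for r
  proof -
    consider "H (\<phi>a r 0) \<ge> 0" | "H (\<phi>a r d) \<le> 0" | "H (\<phi>a r 0) < 0" "H (\<phi>a r d) > 0" by linarith
    then show ?thesis
    proof cases
      case 1
      then show ?thesis using a_incr[OF r, of 0] d by (intro bexI[of _ 0]) force+
    next
      case 2
      then show ?thesis using a_incr[OF r, of _ d] d by (intro bexI[of _ d]) force+
    next
      case 3
      have "continuous_on {0..d} (\<lambda>s. case (r, s) of (r, s) \<Rightarrow> H (\<phi>a r s))"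
        by (rule continuous_on_compose2[OF contHa]) (use r in \<open>auto intro!: continuous_intros\<close>)
      then obtain \<tau> where \<tau>: "0 \<le> \<tau>" "\<tau> \<le> d" "H (\<phi>a r \<tau>) = 0"
        using IVT'[of "\<lambda>s. H (\<phi>a r s)" 0 0 d] 3 d by auto
      then show ?thesis using a_incr[OF r, of _ \<tau>] a_incr[OF r, of \<tau>] by (intro bexI[of _ \<tau>]) force+
    qed
  qed
  then have "\<forall>r\<in>W. \<exists>\<tau>. \<tau> \<in> {0..d} \<and> (\<forall>s\<in>{0..d}. s < \<tau> \<longrightarrow> H (\<phi>a r s) < 0) \<and>
      (\<forall>s\<in>{0..d}. \<tau> < s \<longrightarrow> H (\<phi>a r s) > 0) \<and>
      (H (\<phi>a r 0) < 0 \<longrightarrow> H (\<phi>a r d) > 0 \<longrightarrow> H (\<phi>a r \<tau>) = 0)"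
    unfolding Bex_def by blast
  from bchoice[OF this] obtain \<tau> where \<tau>: "\<forall>r\<in>W. \<tau> r \<in> {0..d} \<and>
      (\<forall>s\<in>{0..d}. s < \<tau> r \<longrightarrow> H (\<phi>a r s) < 0) \<and>
      (\<forall>s\<in>{0..d}. \<tau> r < s \<longrightarrow> H (\<phi>a r s) > 0) \<and>
      (H (\<phi>a r 0) < 0 \<longrightarrow> H (\<phi>a r d) > 0 \<longrightarrow> H (\<phi>a r (\<tau> r)) = 0)"
    by blast
  have \<tau>d: "r \<in> W \<Longrightarrow> \<tau> r \<in> {0..d}"
    and \<tau>neg: "\<And>s. r \<in> W \<Longrightarrow> s \<in> {0..d} \<Longrightarrow> s < \<tau> r \<Longrightarrow> H (\<phi>a r s) < 0"
    and \<tau>pos: "\<And>s. r \<in> W \<Longrightarrow> s \<in> {0..d} \<Longrightarrow> \<tau> r < s \<Longrightarrow> H (\<phi>a r s) > 0"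
    and \<tau>0: "r \<in> W \<Longrightarrow> H (\<phi>a r 0) < 0 \<Longrightarrow> H (\<phi>a r d) > 0 \<Longrightarrow> H (\<phi>a r (\<tau> r)) = 0" for r
    using \<tau> by blast+
  \<comment> \<open>The sign pattern alone gives continuity: for \<open>s\<close> strictly between
    \<open>e\<close> and \<open>\<tau> r\<close> the sign of \<open>H\<close> at time
    \<open>s\<close> is strict, hence the same for nearby starting points, whose hitting time is
    then on the same side of \<open>s\<close>.\<close>
  have cont\<tau>: "continuous_on W \<tau>"
    unfolding continuous_on_def
  proof (intro ballI order_tendstoI)
    fix r e assume r: "r \<in> W"
    have lim: "((\<lambda>r. H (\<phi>a r s)) \<longlongrightarrow> H (\<phi>a r s)) (at r within W)" if "s \<in> {0..d}" for s
    proof -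
      have "continuous_on W (\<lambda>r. case (r, s) of (r, s) \<Rightarrow> H (\<phi>a r s))"
        by (rule continuous_on_compose2[OF contHa]) (use that in \<open>auto intro!: continuous_intros\<close>)
      then show ?thesis using r by (simp add: continuous_on_def)
    qed
    have inW: "\<forall>\<^sub>F r' in at r within W. r' \<in> W" by (simp add: eventually_at_filter)
    show "\<forall>\<^sub>F r' in at r within W. e < \<tau> r'" if e: "e < \<tau> r"
    proof (cases "e < 0")
      case True
      show ?thesis using inW by eventually_elim (use True \<tau>d in force)
    next
      case False
      obtain s where s: "e < s" "s < \<tau> r" using e dense by blast
      then have s': "s \<in> {0..d}" using False \<tau>d[OF r] by auto
      have "\<forall>\<^sub>F r' in at r within W. H (\<phi>a r' s) < 0"
        by (rule order_tendstoD(2)[OF lim[OF s'] \<tau>neg[OF r s' s(2)]])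
      with inW show ?thesis
      proof eventually_elim
        case (elim r')
        then have "\<not> \<tau> r' < s" using \<tau>pos[of r' s] s' by force
        then show ?case using s by simp
      qed
    qed
    show "\<forall>\<^sub>F r' in at r within W. \<tau> r' < e" if e: "\<tau> r < e"
    proof (cases "e > d")
      case True
      show ?thesis using inW by eventually_elim (use True \<tau>d in force)
    next
      case False
      obtain s where s: "\<tau> r < s" "s < e" using e dense by blast
      then have s': "s \<in> {0..d}" using False \<tau>d[OF r] by auto
      have "\<forall>\<^sub>F r' in at r within W. H (\<phi>a r' s) > 0"
        by (rule order_tendstoD(1)[OF lim[OF s'] \<tau>pos[OF r s' s(1)]])
      with inW show ?thesis
      proof eventually_elim
        case (elim r')
        then have "\<not> s < \<tau> r'" using \<tau>neg[of r' s] s' by force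
        then show ?case using s by simp
      qed
    qed
  qed
  \<comment> \<open>Growth of \<open>H\<close> puts all earlier times on the side
    \<open>H < 0\<close>: an incoming piece may end on the surface but not cross it.\<close>
  have solA: "local_solution t (\<phi>a r)" if r: "r \<in> W" and t: "t \<in> {0..d}" and Ht: "H (\<phi>a r t) \<le> 0" for r t
  proof (rule trajectory_local_solution[OF a])
    show "trajectory_on (X a) {0..t} (\<phi>a r)" by (rule trajectory_on_subset[OF a_traj[OF r]]) (use t in auto)
    have in\<rho>: "\<phi>a r s \<in> ball p \<rho>" if "s \<in> {0..d}" for s using a_in[OF r that] W'\<rho> by blast
    show "\<phi>a r s \<in> A a" if "0 < s" "s < t" for s
      using neg[OF in\<rho>[of s]] a_incr[OF r, of s t] Ht t that by auto
    show "\<phi>a r 0 \<in> \<Sigma> \<Longrightarrow> crossing (\<phi>a r 0)" "\<phi>a r t \<in> \<Sigma> \<Longrightarrow> crossing (\<phi>a r t)"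
      using cross[OF in\<rho>[of 0]] cross[OF in\<rho>[of t]] t d by auto
  qed
  have solB: "local_solution t (\<phi>b r)" if r: "r \<in> W'" and t: "t \<in> {0..d}" and Hr: "H r \<ge> 0" for r t
  proof (rule trajectory_local_solution[OF b])
    show "trajectory_on (X b) {0..t} (\<phi>b r)" by (rule trajectory_on_subset[OF b_traj[OF r]]) (use t in auto)
    have in\<rho>: "\<phi>b r s \<in> ball p \<rho>" if "s \<in> {0..d}" for s using b_in[OF r that] .
    have r0: "\<phi>b r 0 = r" using \<phi>b0 r by (simp add: W'_def)
    show "\<phi>b r s \<in> A b" if "0 < s" "s < t" for s
      using pos[OF in\<rho>[of s]] b_incr[OF r, of 0 s] Hr t that r0 by auto
    show "\<phi>b r 0 \<in> \<Sigma> \<Longrightarrow> crossing (\<phi>b r 0)" "\<phi>b r t \<in> \<Sigma> \<Longrightarrow> crossing (\<phi>b r t)"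
      using cross[OF in\<rho>[of 0]] cross[OF in\<rho>[of t]] t d by auto
  qed
  \<comment> \<open>A start with \<open>H \<ge> 0\<close> has \<open>\<tau> r = 0\<close> and
    follows \<open>X b\<close> throughout; if the surface is not passed by time \<open>t\<close>,
    the second duration is 0 and only \<open>X a\<close> acts.\<close>
  have "continuous_flow W t (\<lambda>r. \<phi>b (\<phi>a r (min t (\<tau> r))) (max 0 (t - \<tau> r)))" if t: "t \<in> {0..d}" for t
    unfolding continuous_flow_def
  proof (intro conjI ballI)
    have m1: "min t (\<tau> r) \<in> {0..d}" if "r \<in> W" for r using \<tau>d[OF that] t by auto
    have m2: "max 0 (t - \<tau> r) \<in> {0..d}" if "r \<in> W" for r using \<tau>d[OF that] t by auto
    have "continuous_on W (\<lambda>r. case (r, min t (\<tau> r)) of (r, s) \<Rightarrow> \<phi>a r s)"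
    proof (rule continuous_on_compose2[OF conta])
      show "continuous_on W (\<lambda>r. (r, min t (\<tau> r)))" by (intro continuous_intros cont\<tau>)
      show "(\<lambda>r. (r, min t (\<tau> r))) ` W \<subseteq> ball p (\<sigma>/2/2) \<times> {0..da}"
      proof (rule image_subsetI, rule SigmaI)
        fix r assume r: "r \<in> W"
        show "r \<in> ball p (\<sigma>/2/2)" using r by (simp add: W_def)
        show "min t (\<tau> r) \<in> {0..da}" using m1[OF r] d by auto
      qed
    qed
    then have ca: "continuous_on W (\<lambda>r. \<phi>a r (min t (\<tau> r)))" by simp
    have "continuous_on W (\<lambda>r. case (\<phi>a r (min t (\<tau> r)), max 0 (t - \<tau> r)) of (r, s) \<Rightarrow> \<phi>b r s)"
    proof (rule continuous_on_compose2[OF contb])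
      show "continuous_on W (\<lambda>r. (\<phi>a r (min t (\<tau> r)), max 0 (t - \<tau> r)))"
        by (intro continuous_intros ca cont\<tau>)
      show "(\<lambda>r. (\<phi>a r (min t (\<tau> r)), max 0 (t - \<tau> r))) ` W \<subseteq> ball p (\<sigma>/2) \<times> {0..db}"
      proof (rule image_subsetI, rule SigmaI)
        fix r assume r: "r \<in> W"
        show "\<phi>a r (min t (\<tau> r)) \<in> ball p (\<sigma>/2)" using a_in[OF r m1[OF r]] by (simp add: W'_def)
        show "max 0 (t - \<tau> r) \<in> {0..db}" using m2[OF r] d by auto
      qed
    qed
    then show "continuous_on W (\<lambda>r. \<phi>b (\<phi>a r (min t (\<tau> r))) (max 0 (t - \<tau> r)))" by simp
    fix r assume r: "r \<in> W"
    let ?\<Psi> = "\<phi>b (\<phi>a r (min t (\<tau> r))) (max 0 (t - \<tau> r))"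
    have rW': "r \<in> W'" using r WW' by blast
    have a0: "\<phi>a r 0 = r" using \<phi>a0 r by (simp add: W_def)
    have b0: "\<phi>b q 0 = q" if "q \<in> W'" for q using \<phi>b0 that by (simp add: W'_def)
    consider "H r \<ge> 0" | "H r < 0" "H (\<phi>a r t) \<le> 0" | "H r < 0" "H (\<phi>a r t) > 0" by linarith
    then show "\<exists>\<gamma>. \<gamma> 0 = r \<and> local_solution t \<gamma> \<and> \<gamma> t = ?\<Psi>"
    proof cases
      case 1
      have "\<tau> r = 0" using \<tau>neg[OF r, of 0] \<tau>d[OF r] 1 a0 d by fastforce
      then have "?\<Psi> = \<phi>b r t" using t a0 by simp
      then show ?thesis using solB[OF rW' t 1] b0[OF rW'] by metis
    next
      case 2
      have "t \<le> \<tau> r" using \<tau>pos[OF r t] 2 by force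
      then have "?\<Psi> = \<phi>a r t" using b0[OF a_in[OF r t]] by simp
      then show ?thesis using solA[OF r t 2(2)] a0 by metis
    next
      case 3
      \<comment> \<open>\<open>H\<close> is still positive at time \<open>d\<close>, so
        \<open>\<tau> r\<close> is a genuine zero and not a truncated value.\<close>
      have "H (\<phi>a r t) \<le> H (\<phi>a r d)" using a_incr[OF r, of t d] t by (cases "t = d") auto
      then have z: "H (\<phi>a r (\<tau> r)) = 0" using \<tau>0[OF r] 3 a0 by simp
      have \<tau>t: "\<tau> r < t"
      proof (rule ccontr)
        assume "\<not> \<tau> r < t"
        then have "H (\<phi>a r t) \<le> H (\<phi>a r (\<tau> r))"
          using a_incr[OF r, of t "\<tau> r"] t \<tau>d[OF r] by (cases "t = \<tau> r") auto
        then show False using z 3 by simp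
      qed
      let ?q = "\<phi>a r (\<tau> r)"
      have q: "?q \<in> W'" by (rule a_in[OF r \<tau>d[OF r]])
      have dt: "t - \<tau> r \<in> {0..d}" using \<tau>t \<tau>d[OF r] t by auto
      have "local_solution (\<tau> r + (t - \<tau> r)) (\<lambda>s. if s \<le> \<tau> r then \<phi>a r s else \<phi>b ?q (s - \<tau> r))"
        by (rule local_solution_concat[OF solA[OF r \<tau>d[OF r]] solB[OF q dt]])
          (use z \<tau>d[OF r] \<tau>t b0[OF q] in auto)
      then show ?thesis
        using \<tau>t \<tau>d[OF r] a0
        by (intro exI[of _ "\<lambda>s. if s \<le> \<tau> r then \<phi>a r s else \<phi>b ?q (s - \<tau> r)"]) auto
    qed
  qed
  moreover have "open W" "p \<in> W" using \<sigma>(1) by (auto simp: W_def)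
  ultimately show ?thesis using d(1) by blast
qed

section \<open>Patching the local flows along an orbit\<close>

lemma local_continuous_flow:
  assumes "p \<in> \<Sigma> \<longrightarrow> crossing p"
  obtains W \<delta> where "open W" "p \<in> W" "\<delta> > 0" "\<And>t. t \<in> {0..\<delta>} \<Longrightarrow> \<exists>\<Psi>. continuous_flow W t \<Psi>"
  using assms A_cover interior_local_flow crossing_local_flow by metis

text \<open>Uniqueness identifies the witness solution with \<open>\<gamma>\<close>. This is how a
  local time map is known to send a point of the orbit to the later point on it.\<close>

lemma continuous_flow_along:
  assumes "continuous_flow U T \<Psi>" "local_solution T \<gamma>" "\<gamma> 0 \<in> U" "0 \<le> T"
  shows "\<Psi> (\<gamma> 0) = \<gamma> T"
proof -
  obtain \<gamma>' where "\<gamma>' 0 = \<gamma> 0" "local_solution T \<gamma>'" "\<gamma>' T = \<Psi> (\<gamma> 0)"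
    using assms(1,3) unfolding continuous_flow_def by blast
  then show ?thesis using local_solution_unique[of T \<gamma>' \<gamma> T] assms by auto
qed

text \<open>Compactness takes the form of interval bisection: the property \<open>P\<close> passes
  from two adjacent time intervals to their union and holds for all short intervals around a given
  time.\<close>

lemma continuous_flow_near_solution:
  assumes sol: "local_solution T \<gamma>" and T: "0 \<le> T"
  obtains U \<Psi> where "open U" "\<gamma> 0 \<in> U" "continuous_flow U T \<Psi>"
proof -
  \<comment> \<open>The premises make \<open>P\<close> vacuous for intervals that stick out of
    \<open>{0..T}\<close>, which \<open>Bolzano\<close> does not rule out near the two ends.\<close>
  define P where "P s t \<longleftrightarrow> (0 \<le> s \<longrightarrow> s \<le> t \<longrightarrow> t \<le> T \<longrightarrow>
    (\<exists>U \<Psi>. open U \<and> \<gamma> s \<in> U \<and> continuous_flow U (t - s) \<Psi>))" for s t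
  have "P 0 T"
    using T
  proof (induction rule: Bolzano)
    case (trans a b c)
    show ?case
      unfolding P_def
    proof (intro impI)
      assume ac: "0 \<le> a" "a \<le> c" "c \<le> T"
      obtain U1 \<Psi>1 where 1: "open U1" "\<gamma> a \<in> U1" "continuous_flow U1 (b - a) \<Psi>1"
        using trans ac unfolding P_def by (meson order_trans)
      obtain U2 \<Psi>2 where 2: "open U2" "\<gamma> b \<in> U2" "continuous_flow U2 (c - b) \<Psi>2"
        using trans ac unfolding P_def by (meson order_trans)
      have "local_solution (b - a) (\<lambda>t. \<gamma> (t + a))"
        by (rule local_solution_restrict[OF sol]) (use trans ac in auto)
      from continuous_flow_along[OF 1(3) this] have eq: "\<Psi>1 (\<gamma> a) = \<gamma> b"
        using 1(2) trans by simp
      have c1: "continuous_on U1 \<Psi>1" and c2: "continuous_on U2 \<Psi>2"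
        using 1(3) 2(3) by (auto simp: continuous_flow_def)
      \<comment> \<open>Shrunk so that the first map lands where the second is defined;
        \<open>\<gamma> a\<close> survives because its image \<open>\<gamma> b\<close> lies in
        \<open>U2\<close>.\<close>
      define U where "U = U1 \<inter> \<Psi>1 -` U2"
      have "open U" unfolding U_def by (rule continuous_open_preimage[OF c1 1(1) 2(1)])
      moreover have "\<gamma> a \<in> U" using 1 2 eq by (simp add: U_def)
      moreover have "continuous_flow U (c - a) (\<lambda>r. \<Psi>2 (\<Psi>1 r))"
        unfolding continuous_flow_def
      proof (intro conjI ballI)
        show "continuous_on U (\<lambda>r. \<Psi>2 (\<Psi>1 r))"
          by (rule continuous_on_compose2[OF c2 continuous_on_subset[OF c1]]) (auto simp: U_def)
        fix r assume r: "r \<in> U"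
        then obtain \<gamma>1 where \<gamma>1: "\<gamma>1 0 = r" "local_solution (b - a) \<gamma>1" "\<gamma>1 (b - a) = \<Psi>1 r"
          using 1(3) unfolding U_def continuous_flow_def by blast
        obtain \<gamma>2 where \<gamma>2: "\<gamma>2 0 = \<Psi>1 r" "local_solution (c - b) \<gamma>2" "\<gamma>2 (c - b) = \<Psi>2 (\<Psi>1 r)"
          using 2(3) r unfolding U_def continuous_flow_def by blast
        let ?\<gamma> = "\<lambda>t. if t \<le> b - a then \<gamma>1 t else \<gamma>2 (t - (b - a))"
        have "local_solution ((b - a) + (c - b)) ?\<gamma>"
          by (rule local_solution_concat[OF \<gamma>1(2) \<gamma>2(2)]) (use trans \<gamma>1 \<gamma>2 in auto)
        moreover have "?\<gamma> 0 = r" using \<gamma>1 trans by simp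
        moreover have "?\<gamma> (c - a) = \<Psi>2 (\<Psi>1 r)"
          \<comment> \<open>For \<open>b = c\<close> the endpoint falls under the first branch of
            \<open>?\<gamma>\<close>, and the values agree because \<open>\<gamma>2\<close> has
            duration 0.\<close>
          using \<gamma>1 \<gamma>2 trans by (cases "b = c") auto
        ultimately show "\<exists>\<gamma>. \<gamma> 0 = r \<and> local_solution (c - a) \<gamma> \<and> \<gamma> (c - a) = \<Psi>2 (\<Psi>1 r)"
          by (intro exI[of _ ?\<gamma>]) simp
      qed
      ultimately show "\<exists>U \<Psi>. open U \<and> \<gamma> a \<in> U \<and> continuous_flow U (c - a) \<Psi>" by blast
    qed
  next
    case (local t)
    then have t: "t \<in> {0..T}" by simp
    then have "\<gamma> t \<in> \<Sigma> \<longrightarrow> crossing (\<gamma> t)" using sol by (simp add: local_solution_def)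
    then obtain W \<delta> where W: "open W" "\<gamma> t \<in> W" "\<delta> > 0"
      "\<And>s. s \<in> {0..\<delta>} \<Longrightarrow> \<exists>\<Psi>. continuous_flow W s \<Psi>"
      using local_continuous_flow by metis
    have "\<forall>\<^sub>F s in at t within {0..T}. \<gamma> s \<in> W"
      using local_solution_continuous[OF sol] t W(1,2)
      unfolding continuous_on_def by (metis topological_tendstoD)
    then obtain \<eta> where \<eta>: "\<eta> > 0" "\<And>s. s \<in> {0..T} \<Longrightarrow> s \<noteq> t \<Longrightarrow> dist s t < \<eta> \<Longrightarrow> \<gamma> s \<in> W"
      unfolding eventually_at by blast
    show ?case
    proof (intro exI[of _ "min \<eta> \<delta>"] conjI allI impI)
      show "0 < min \<eta> \<delta>" using \<eta> W by simp
      fix a b assume ab: "a \<le> t \<and> t \<le> b \<and> b - a < min \<eta> \<delta>"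
      show "P a b"
        unfolding P_def
      proof (intro impI)
        assume "0 \<le> a" "a \<le> b" "b \<le> T"
        then have "\<gamma> a \<in> W" using \<eta>(2)[of a] W(2) ab by (cases "a = t") (auto simp: dist_real_def)
        moreover have "b - a \<in> {0..\<delta>}" using ab by auto
        ultimately show "\<exists>U \<Psi>. open U \<and> \<gamma> a \<in> U \<and> continuous_flow U (b - a) \<Psi>"
          using W(1,4) by blast
      qed
    qed
  qed
  then show ?thesis using T that by (auto simp: P_def)
qed

lemma time_map_eq:
  assumes "continuous_flow U T \<Psi>" "r \<in> U" "0 \<le> T"
  shows "time_map N h k A X T r = \<Psi> r" "arc_well_defined N h k A X T r"
proof -
  obtain \<gamma> where \<gamma>: "\<gamma> 0 = r" "local_solution T \<gamma>" "\<gamma> T = \<Psi> r"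
    using assms(1,2) unfolding continuous_flow_def by blast
  show "time_map N h k A X T r = \<Psi> r"
    using flow_eq[OF \<gamma>(2) assms(3)] \<gamma> by (simp add: time_map_def)
  show "arc_well_defined N h k A X T r"
    unfolding arc_well_defined_def using \<gamma> solution_on_iff by blast
qed

text \<open>Run backwards, the witness for \<open>r\<close> is a solution of the negated field from
  \<open>\<Psi> r\<close> to \<open>r\<close>, and by uniqueness \<open>\<Psi>'\<close> must follow
  it.\<close>

lemma reverse_flow_inverse:
  assumes U: "continuous_flow U T \<Psi>" and T: "0 \<le> T"
    and V: "piecewise_field.continuous_flow N h k A (\<lambda>j y. - X j y) V T \<Psi>'"
    and r: "r \<in> U" "\<Psi> r \<in> V"
  shows "\<Psi>' (\<Psi> r) = r"
proof -
  interpret rev: piecewise_field N h k A "\<lambda>j y. - X j y" by (rule reversed)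
  obtain \<gamma> where \<gamma>: "\<gamma> 0 = r" "local_solution T \<gamma>" "\<gamma> T = \<Psi> r"
    using U r(1) unfolding continuous_flow_def by blast
  show ?thesis
    using rev.continuous_flow_along[OF V local_solution_reverse[OF \<gamma>(2)]] \<gamma> r T by simp
qed

end

theorem proposition4:
  fixes h :: "nat \<Rightarrow> real ^ 'n \<Rightarrow> real"
    and A :: "nat \<Rightarrow> (real ^ 'n) set"
    and X :: "nat \<Rightarrow> real ^ 'n \<Rightarrow> real ^ 'n"
    and N k :: nat
    and x :: "real ^ 'n"
    and T :: real
  assumes "CARD('n) \<ge> 2"
    and "piecewise_smooth_field N h k A X"
    and "T > 0"
    and "arc_well_defined N h k A X T x"
    and "\<forall>t\<in>{0..T}. flow N h k A X t x \<in> switching_set N h \<longrightarrow>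
           crossing_point N h k A X (flow N h k A X t x)"
  shows "\<exists>U V g. open U \<and> x \<in> U \<and> open V \<and> time_map N h k A X T x \<in> V \<and>
           (\<forall>r\<in>U. arc_well_defined N h k A X T r) \<and>
           homeomorphism U V (time_map N h k A X T) g"
proof -
  interpret piecewise_field N h k A X by standard (rule assms(2))
  interpret rev: piecewise_field N h k A "\<lambda>j y. - X j y" by (rule reversed)
  have T: "0 \<le> T" using assms(3) by simp
  obtain \<gamma> where \<gamma>: "\<gamma> 0 = x" "local_solution T \<gamma>"
    using assms(4) solution_on_iff unfolding arc_well_defined_def by blast
  obtain U1 \<Psi> where U1: "open U1" "x \<in> U1" "continuous_flow U1 T \<Psi>"
    using continuous_flow_near_solution[OF \<gamma>(2) T] \<gamma>(1) by metis
  obtain V1 \<Psi>' where V1: "open V1" "\<gamma> T \<in> V1" "rev.continuous_flow V1 T \<Psi>'"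
    using rev.continuous_flow_near_solution[OF local_solution_reverse[OF \<gamma>(2)] T] by auto
  have c: "continuous_on U1 \<Psi>" and c': "continuous_on V1 \<Psi>'"
    using U1(3) V1(3) by (auto simp: continuous_flow_def rev.continuous_flow_def)
  have inv: "\<Psi>' (\<Psi> r) = r" if "r \<in> U1" "\<Psi> r \<in> V1" for r
    by (rule reverse_flow_inverse[OF U1(3) T V1(3) that])
  have inv': "\<Psi> (\<Psi>' v) = v" if "v \<in> V1" "\<Psi>' v \<in> U1" for v
    \<comment> \<open>The same lemma for the reversed field, whose own reversal simplifies to
      \<open>X\<close>.\<close>
    by (rule rev.reverse_flow_inverse[OF V1(3) T _ that]) (use U1(3) in simp)
  \<comment> \<open>Each set is cut down to the points whose image lies in the domain of the other
    map. With the two inverse laws \<open>\<Psi>\<close> maps \<open>U\<close> onto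
    \<open>V\<close>, and both sets are open as preimages under continuous maps.\<close>
  define U where "U = U1 \<inter> \<Psi> -` V1"
  define V where "V = V1 \<inter> \<Psi>' -` U1"
  have \<Psi>x: "\<Psi> x = \<gamma> T" using continuous_flow_along[OF U1(3) \<gamma>(2) _ T] \<gamma>(1) U1(2) by simp
  have tm: "time_map N h k A X T r = \<Psi> r" "arc_well_defined N h k A X T r" if "r \<in> U" for r
    using time_map_eq[OF U1(3) _ T] that by (auto simp: U_def)
  have "open U" unfolding U_def by (rule continuous_open_preimage[OF c U1(1) V1(1)])
  moreover have "open V" unfolding V_def by (rule continuous_open_preimage[OF c' V1(1) U1(1)])
  moreover have xU: "x \<in> U" using U1(2) V1(2) \<Psi>x by (simp add: U_def)
  moreover have hom: "homeomorphism U V \<Psi> \<Psi>'"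
  proof (rule homeomorphismI)
    show "continuous_on U \<Psi>" by (rule continuous_on_subset[OF c]) (simp add: U_def)
    show "continuous_on V \<Psi>'" by (rule continuous_on_subset[OF c']) (simp add: V_def)
  qed (auto simp: U_def V_def inv inv')
  moreover have "homeomorphism U V (time_map N h k A X T) \<Psi>'"
    by (rule homeomorphism_cong[OF hom]) (use tm in auto)
  moreover have "time_map N h k A X T x \<in> V"
    using hom xU tm(1)[OF xU] by (metis homeomorphism_image1 imageI)
  ultimately show ?thesis using tm(2) by blast
qed

end
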